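(* Let $h\ge 0$ and $0<\beta<\beta_0:=\beta_c/\sqrt{4\alpha}$, where $\alpha=1+\mathbf 1\{\Delta^2\text{ is indefinite}\}$. Then for every real $\eta>0$ with $2\eta<\beta_c^2-4\alpha\beta^2$, $$\nu\big(\exp(\eta N\mathcal P(\overline{\mathbf R}_{12}))\big)\le \det\big(I-(2\eta+4\alpha\beta^2)\mathcal V\big)^{-1/2},$$ where $\mathcal P(\mathbf x)=\mathbf x^{\top}\Lambda^{1/2}\mathcal V\Lambda^{1/2}\mathbf x$.
   Context: Multi-species SK model. $m\ge2$; $\Delta^2=(\Delta^2_{s,t})_{s,t=1}^m$ is a symmetric invertible nonzero real matrix with non-negative entries (not necessarily positive-definite). $\{1,\dots,N\}$ is partitioned into disjoint nonempty species $I_1,\dots,I_m$, $\lambda_s=|I_s|/N\in(0,1)$, $\Lambda=\mathrm{diag}(\lambda_1,\dots,\lambda_m)$. The disorder $(g_{ij})_{1\le i<j\le N}$ consists of independent centered Gaussians with $\mathbb E g_{ij}^2=\Delta^2_{s,t}$ when $i\in I_s$, $j\in I_t$. For $\sigma\in\Sigma_N=\{-1,1\}^N$, $H_N(\sigma)=\frac{\beta}{\sqrt N}\sum_{i<j}g_{ij}\sigma_i\sigma_j+h\sum_i\sigma_i$, $Z_N=\sum_\sigma e^{H_N(\sigma)}$, and the Gibbs measure is $G_N(\sigma)=e^{H_N(\sigma)}/Z_N$. $\langle\cdot\rangle$ is the average over i.i.d. replicas $\sigma^1,\sigma^2,\dots$ from $G_N$ and $\nu(\cdot)=\mathbb E\langle\cdot\rangle$.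 Overlap vector: $\mathbf R_{12}=(R^{(1)}_{12},\dots,R^{(m)}_{12})^{\top}$, $R^{(s)}_{12}=\frac1{|I_s|}\sum_{i\in I_s}\sigma_i^1\sigma_i^2$. $\beta_c=\rho(\Delta^2\Lambda)^{-1/2}$ with $\rho$ the spectral radius. $\mathcal V=|\Lambda^{1/2}\Delta^2\Lambda^{1/2}|$ is obtained by replacing the eigenvalues of the symmetric matrix $\Lambda^{1/2}\Delta^2\Lambda^{1/2}$ by their absolute values in its spectral decomposition. $\overline{\mathbf R}_{12}=\mathbf R_{12}-\mathbf q$, where $\mathbf q\in[0,1]^m$ is the unique solution (it exists and is unique since $\beta<\beta_c$) of $q_s=\mathbb E\tanh^2(\beta z\sqrt{(\Delta^2\Lambda\mathbf q)_s}+h)$, $s=1,\dots,m$, $z\sim N(0,1)$. *)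

theory Defs
  imports "HOL-Probability.Probability"
begin

section \<open>Matrices\<close>

definition diag :: "real ^ 'm \<Rightarrow> real ^ 'm ^ 'm::finite" where
  "diag d = (\<chi> i j. if i = j then d $ i else 0)"

text \<open>The eigenvalues are the complex ones, since \<open>\<Delta>\<^sup>2 \<Lambda>\<close> need not be symmetric.\<close>

definition spectral_rad :: "real ^ 'm ^ 'm::finite \<Rightarrow> real" where
  "spectral_rad A =
     Max (norm ` {k :: complex. \<exists>v. v \<noteq> 0 \<and> map_matrix complex_of_real A *v v = k *s v})"

text \<open>
  The absolute value of a symmetric matrix. A matrix \<open>U diag(d) U\<^sup>T\<close> may have several such
  decompositions, but all of them give the same \<open>U diag(|d|) U\<^sup>T\<close>, so the description is
  definite for every symmetric \<open>A\<close>.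
\<close>

definition matrix_abs :: "real ^ 'm ^ 'm::finite \<Rightarrow> real ^ 'm ^ 'm" where
  "matrix_abs A = (THE B. \<exists>U d. orthogonal_matrix U \<and>
     A = U ** diag d ** transpose U \<and>
     B = U ** diag (\<chi> i. \<bar>d $ i\<bar>) ** transpose U)"

definition indefinite :: "real ^ 'm ^ 'm::finite \<Rightarrow> bool" where
  "indefinite A \<longleftrightarrow> (\<exists>x. x \<bullet> (A *v x) > 0) \<and> (\<exists>x. x \<bullet> (A *v x) < 0)"


section \<open>Gaussian variables\<close>

text \<open>The variance \<open>v\<close> may be \<open>0\<close>, in which case this is the point mass at \<open>0\<close>.\<close>

definition centered_gaussian :: "real \<Rightarrow> real measure" where
  "centered_gaussian v = distr std_normal_distribution borel (\<lambda>z. sqrt v * z)"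


section \<open>The multi-species SK model\<close>

text \<open>
  Species are the elements of a finite type \<open>'m\<close>, sites are the numbers \<open>1, \<dots>, N\<close>,
  \<open>Sp s\<close> is the set of sites of species \<open>s\<close>, and \<open>D\<close> is the matrix \<open>\<Delta>\<^sup>2\<close>.
\<close>

definition species_partition :: "nat \<Rightarrow> ('m::finite \<Rightarrow> nat set) \<Rightarrow> bool" where
  "species_partition N Sp \<longleftrightarrow>
     disjoint_family Sp \<and> (\<forall>s. Sp s \<noteq> {}) \<and> (\<Union>s. Sp s) = {1..N}"

definition species_ratio :: "nat \<Rightarrow> ('m::finite \<Rightarrow> nat set) \<Rightarrow> real ^ 'm" where
  "species_ratio N Sp = (\<chi> s. real (card (Sp s)) / real N)"

definition Lam :: "nat \<Rightarrow> ('m::finite \<Rightarrow> nat set) \<Rightarrow> real ^ 'm ^ 'm" where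
  "Lam N Sp = diag (species_ratio N Sp)"

definition sqrt_Lam :: "nat \<Rightarrow> ('m::finite \<Rightarrow> nat set) \<Rightarrow> real ^ 'm ^ 'm" where
  "sqrt_Lam N Sp = diag (\<chi> s. sqrt (species_ratio N Sp $ s))"

definition site_pairs :: "nat \<Rightarrow> (nat \<times> nat) set" where
  "site_pairs N = {(i, j). 1 \<le> i \<and> i < j \<and> j \<le> N}"

definition gaussian_disorder ::
  "'a measure \<Rightarrow> nat \<Rightarrow> ('m::finite \<Rightarrow> nat set) \<Rightarrow> real ^ 'm ^ 'm
     \<Rightarrow> (nat \<Rightarrow> nat \<Rightarrow> 'a \<Rightarrow> real) \<Rightarrow> bool" where
  "gaussian_disorder M N Sp D g \<longleftrightarrow>
     prob_space M \<and>
     prob_space.indep_vars M (\<lambda>_. borel) (\<lambda>(i, j). g i j) (site_pairs N) \<and>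
     (\<forall>(i, j) \<in> site_pairs N. \<forall>s t. i \<in> Sp s \<longrightarrow> j \<in> Sp t \<longrightarrow>
        distr M borel (g i j) = centered_gaussian (D $ s $ t))"

definition configs :: "nat \<Rightarrow> (nat \<Rightarrow> real) set" where
  "configs N = ({1..N} \<rightarrow>\<^sub>E {-1, 1})"

text \<open>In the next four definitions \<open>g\<close> is a realization of the disorder.\<close>

definition hamiltonian ::
  "nat \<Rightarrow> real \<Rightarrow> real \<Rightarrow> (nat \<Rightarrow> nat \<Rightarrow> real) \<Rightarrow> (nat \<Rightarrow> real) \<Rightarrow> real" where
  "hamiltonian N \<beta> h g \<sigma> =
     \<beta> / sqrt (real N) * (\<Sum>(i, j) \<in> site_pairs N. g i j * \<sigma> i * \<sigma> j) + h * (\<Sum>i = 1..N. \<sigma> i)"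

definition partition_fn :: "nat \<Rightarrow> real \<Rightarrow> real \<Rightarrow> (nat \<Rightarrow> nat \<Rightarrow> real) \<Rightarrow> real" where
  "partition_fn N \<beta> h g = (\<Sum>\<sigma> \<in> configs N. exp (hamiltonian N \<beta> h g \<sigma>))"

definition gibbs ::
  "nat \<Rightarrow> real \<Rightarrow> real \<Rightarrow> (nat \<Rightarrow> nat \<Rightarrow> real) \<Rightarrow> (nat \<Rightarrow> real) \<Rightarrow> real" where
  "gibbs N \<beta> h g \<sigma> = exp (hamiltonian N \<beta> h g \<sigma>) / partition_fn N \<beta> h g"

definition gibbs_avg ::
  "nat \<Rightarrow> real \<Rightarrow> real \<Rightarrow> (nat \<Rightarrow> nat \<Rightarrow> real)
     \<Rightarrow> ((nat \<Rightarrow> real) \<Rightarrow> (nat \<Rightarrow> real) \<Rightarrow> real) \<Rightarrow> real" where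
  "gibbs_avg N \<beta> h g f =
     (\<Sum>\<sigma>1 \<in> configs N. \<Sum>\<sigma>2 \<in> configs N. gibbs N \<beta> h g \<sigma>1 * gibbs N \<beta> h g \<sigma>2 * f \<sigma>1 \<sigma>2)"

text \<open>
  \<open>\<nu>(f)\<close> for a function \<open>f\<close> of two replicas. The integrand is bounded by the maximum of \<open>|f|\<close>
  over the finite set of pairs of configurations, so the Bochner integral is a genuine expectation.
\<close>

definition nu ::
  "'a measure \<Rightarrow> nat \<Rightarrow> real \<Rightarrow> real \<Rightarrow> (nat \<Rightarrow> nat \<Rightarrow> 'a \<Rightarrow> real)
     \<Rightarrow> ((nat \<Rightarrow> real) \<Rightarrow> (nat \<Rightarrow> real) \<Rightarrow> real) \<Rightarrow> real" where
  "nu M N \<beta> h g f = (\<integral>\<omega>. gibbs_avg N \<beta> h (\<lambda>i j. g i j \<omega>) f \<partial>M)"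

definition overlap ::
  "('m::finite \<Rightarrow> nat set) \<Rightarrow> (nat \<Rightarrow> real) \<Rightarrow> (nat \<Rightarrow> real) \<Rightarrow> real ^ 'm" where
  "overlap Sp \<sigma>1 \<sigma>2 = (\<chi> s. (\<Sum>i \<in> Sp s. \<sigma>1 i * \<sigma>2 i) / real (card (Sp s)))"

definition beta_c :: "nat \<Rightarrow> ('m::finite \<Rightarrow> nat set) \<Rightarrow> real ^ 'm ^ 'm \<Rightarrow> real" where
  "beta_c N Sp D = spectral_rad (D ** Lam N Sp) powr (-1/2)"

definition alpha :: "real ^ 'm ^ 'm::finite \<Rightarrow> real" where
  "alpha D = 1 + of_bool (indefinite D)"

definition beta_0 :: "nat \<Rightarrow> ('m::finite \<Rightarrow> nat set) \<Rightarrow> real ^ 'm ^ 'm \<Rightarrow> real" where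
  "beta_0 N Sp D = beta_c N Sp D / sqrt (4 * alpha D)"

definition Vmat :: "nat \<Rightarrow> ('m::finite \<Rightarrow> nat set) \<Rightarrow> real ^ 'm ^ 'm \<Rightarrow> real ^ 'm ^ 'm" where
  "Vmat N Sp D = matrix_abs (sqrt_Lam N Sp ** D ** sqrt_Lam N Sp)"

definition Pform :: "nat \<Rightarrow> ('m::finite \<Rightarrow> nat set) \<Rightarrow> real ^ 'm ^ 'm \<Rightarrow> real ^ 'm \<Rightarrow> real" where
  "Pform N Sp D x = x \<bullet> ((sqrt_Lam N Sp ** Vmat N Sp D ** sqrt_Lam N Sp) *v x)"

text \<open>For \<open>\<beta> < \<beta>\<^sub>c\<close> there is exactly one such \<open>q\<close>.\<close>

definition is_rs_overlap ::
  "nat \<Rightarrow> ('m::finite \<Rightarrow> nat set) \<Rightarrow> real ^ 'm ^ 'm \<Rightarrow> real \<Rightarrow> real \<Rightarrow> real ^ 'm \<Rightarrow> bool" where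
  "is_rs_overlap N Sp D \<beta> h q \<longleftrightarrow>
     (\<forall>s. q $ s \<in> {0..1} \<and>
        q $ s = (\<integral>z. (tanh (\<beta> * z * sqrt (((D ** Lam N Sp) *v q) $ s) + h))\<^sup>2
                   \<partial>std_normal_distribution))"

end

theory Submission
  imports Defs
begin

text \<open>
  The model is interpolated with one without interactions, in which each site of species \<open>s\<close> feels an
  independent Gaussian field of variance \<open>\<beta>\<^sup>2 (\<Delta>\<^sup>2 \<Lambda> q)\<^sub>s\<close> besides
  \<open>h\<close>. The observable \<open>exp (c N P(R - q))\<close> is followed along the path (lemma
  \<open>gaussian_comparison\<close>).

  By Gaussian integration by parts (\<open>DERIV_gaussian_interpolation\<close>), the derivative of the mean of an
  observable of two replicas is governed by the difference of the covariances of the two Hamiltonians, evaluated at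
  the overlaps of four replicas. The fields are chosen such that this difference is \<open>\<beta>\<^sup>2 N /
  2\<close> times \<open>Q(R - q)\<close> plus a constant, with \<open>Q(x) = (\<Lambda> x)\<^sup>T \<Delta>\<^sup>2
  \<Lambda> x\<close> (\<open>covariance_difference\<close>), and the constant cancels. The form \<open>P\<close>
  dominates \<open>\<bar>Q\<bar>\<close>, since in the variable \<open>\<Lambda>\<^sup>1\<^sup>/\<^sup>2 x\<close> it
  arises from \<open>Q\<close> by replacing eigenvalues with their absolute values. The overlaps of different pairs of
  replicas have the same law, and \<open>P\<close> is positively correlated with \<open>exp (c N P)\<close>, so the
  mean of \<open>P\<close> at one pair times \<open>exp (c N P)\<close> at another is at most the mean with both
  factors at the same pair (\<open>sum_hess_le\<close>). The growth of the mean is therefore compensated by letting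
  the exponent decrease along the path, from \<open>\<eta> + 2 \<alpha> \<beta>\<^sup>2\<close> at the end without
  interactions to \<open>\<eta>\<close> at the SK end. If \<open>\<Delta>\<^sup>2\<close>, which has nonnegative
  entries, is not indefinite, then \<open>Q\<close> is nonnegative, the terms with negative coefficients can be
  dropped and the compensation is half as large; this is the factor \<open>\<alpha>\<close>.

  At the end without interactions the products \<open>\<sigma>\<^sub>i\<^sup>1 \<sigma>\<^sub>i\<^sup>2\<close> are
  independent with mean \<open>q\<^sub>s\<close>, by the equation that defines \<open>q\<close>. By Hoeffding's lemma,
  the vector \<open>sqrt N \<Lambda>\<^sup>1\<^sup>/\<^sup>2 (R - q)\<close> is sub-Gaussian with variance at most
  that of a standard Gaussian vector (\<open>external_field_subgaussian\<close>). So the exponential moment of the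
  quadratic form \<open>P\<close> is at most its Gaussian value (\<open>gaussian_linearization\<close>), which is the
  determinant in the theorem. It is finite because \<open>2 \<eta> + 4 \<alpha> \<beta>\<^sup>2\<close> is below
  \<open>\<beta>\<^sub>c\<^sup>2\<close>, the inverse of the largest eigenvalue of
  \<open>\<bar>\<Lambda>\<^sup>1\<^sup>/\<^sup>2 \<Delta>\<^sup>2 \<Lambda>\<^sup>1\<^sup>/\<^sup>2\<bar>\<close>: the
  eigenvalues of \<open>\<Delta>\<^sup>2 \<Lambda>\<close> and of \<open>\<Lambda>\<^sup>1\<^sup>/\<^sup>2
  \<Delta>\<^sup>2 \<Lambda>\<^sup>1\<^sup>/\<^sup>2\<close> are the same (\<open>spectral_rad_eq_Max\<close>).
\<close>

section \<open>Symmetric matrices\<close>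

lemma inner_matrix_vector_mult:
  fixes A :: "real ^ 'n::finite ^ 'n"
  shows "x \<bullet> (A *v y) = (transpose A *v x) \<bullet> y"
  by (simp only: transpose_matrix_vector dot_lmul_matrix)

text \<open>
  The Rayleigh quotient attains its maximum on the unit sphere of the orthogonal complement of
  \<open>B\<close>, which is nontrivial by dimension and invariant under \<open>A\<close>. A maximizer is an eigenvector.
\<close>
lemma orthonormal_eigenvectors_extend:
  fixes A :: "real ^ 'n ^ 'n::finite" and B :: "(real ^ 'n) set"
  assumes sym: "transpose A = A" and fin: "finite B" and card: "card B < CARD('n)"
    and eig: "\<And>b. b \<in> B \<Longrightarrow> \<exists>k. A *v b = k *\<^sub>R b"
  shows "\<exists>v k. norm v = 1 \<and> (\<forall>b\<in>B. orthogonal b v) \<and> A *v v = k *\<^sub>R v"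
proof -
  define S where "S = {x. \<forall>b\<in>B. b \<bullet> x = 0}"
  define T where "T = S \<inter> sphere 0 1"
  have selfadj: "x \<bullet> (A *v y) = (A *v x) \<bullet> y" for x y
    using inner_matrix_vector_mult[of x A y] sym by simp
  have "dim (span B) < DIM(real ^ 'n)"
    using dim_le_card'[OF fin] card by simp
  then obtain u where u: "u \<noteq> 0" "\<And>x. x \<in> span (span B) \<Longrightarrow> orthogonal u x"
    using orthogonal_to_subspace_exists[of "span B"] by blast
  then have "(1 / norm u) *\<^sub>R u \<in> T"
    by (auto simp: T_def S_def orthogonal_def inner_commute span_base)
  then have "T \<noteq> {}" by blast
  have "closed S"
    unfolding S_def Collect_ball_eq by (intro closed_INT ballI closed_Collect_eq continuous_intros)
  then have "compact T"
    unfolding T_def by (simp add: closed_Int_compact)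
  have "continuous_on T (\<lambda>x. x \<bullet> (A *v x))"
    by (intro continuous_intros)
  from continuous_attains_sup[OF \<open>compact T\<close> \<open>T \<noteq> {}\<close> this] obtain v where v: "v \<in> T" and vmax: "\<And>x. x \<in> T \<Longrightarrow> x \<bullet> (A *v x) \<le> v \<bullet> (A *v v)"
    by blast
  define k where "k = v \<bullet> (A *v v)"
  \<comment> \<open>The defect \<open>w\<close> lies in \<open>S\<close> and is the direction in which the variation is taken.\<close>
  define w where "w = k *\<^sub>R v - A *v v"
  have vS: "v \<in> S" and vn: "v \<bullet> v = 1" "norm v = 1"
    using v by (auto simp: T_def dot_square_norm)
  have Sadd: "x + t *\<^sub>R y \<in> S" if "x \<in> S" "y \<in> S" for x y t
    using that by (auto simp: S_def inner_add_right)
  have SA: "A *v x \<in> S" if x: "x \<in> S" for x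
    unfolding S_def
  proof (safe)
    fix b assume b: "b \<in> B"
    then obtain c where "A *v b = c *\<^sub>R b" using eig by blast
    then show "b \<bullet> (A *v x) = 0"
      using x b by (simp add: selfadj S_def)
  qed
  have wS: "w \<in> S"
    using Sadd[of "A *v v" "v" "-k"] Sadd[of "k *\<^sub>R v" "A *v v" "-1"] Sadd[of 0 v k] SA[OF vS] vS
    by (simp add: w_def S_def)
  have le: "x \<bullet> (A *v x) \<le> k * (x \<bullet> x)" if x: "x \<in> S" for x
  proof (cases "x = 0")
    case False
    have "(1 / norm x) *\<^sub>R x \<in> T"
      using x False by (auto simp: T_def S_def)
    from vmax[OF this] have "(x \<bullet> (A *v x)) / (norm x)\<^sup>2 \<le> k"
      by (simp add: k_def matrix_vector_mult_scaleR power2_eq_square)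
    then show ?thesis
      using False by (simp add: dot_square_norm divide_simps split: if_splits)
  qed simp
  \<comment> \<open>The nonnegative form \<open>k (x \<bullet> x) - x \<bullet> A x\<close> vanishes at \<open>v\<close>, so its first variation vanishes there.\<close>
  have quad: "0 \<le> 2 * t * (w \<bullet> w) + t\<^sup>2 * (k * (w \<bullet> w) - w \<bullet> (A *v w))" for t
  proof -
    have "0 \<le> k * ((v + t *\<^sub>R w) \<bullet> (v + t *\<^sub>R w)) - (v + t *\<^sub>R w) \<bullet> (A *v (v + t *\<^sub>R w))"
      using le[OF Sadd[OF vS wS], of t] by linarith
    also have "\<dots> = (k * (v \<bullet> v) - v \<bullet> (A *v v)) + 2 * t * (w \<bullet> (k *\<^sub>R v - A *v v))
        + t\<^sup>2 * (k * (w \<bullet> w) - w \<bullet> (A *v w))"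
      using selfadj[of v w]
      by (simp add: algebra_simps inner_add_left inner_add_right inner_diff_right
          matrix_vector_mult_scaleR matrix_vector_right_distrib power2_eq_square inner_commute)
    finally show ?thesis by (simp add: vn k_def flip: w_def[unfolded k_def])
  qed
  have "w \<bullet> w = 0"
  proof (rule ccontr)
    assume "w \<bullet> w \<noteq> 0"
    then have pos: "w \<bullet> w > 0" using inner_ge_zero[of w] by linarith
    define c where "c = \<bar>k * (w \<bullet> w) - w \<bullet> (A *v w)\<bar> + 1"
    \<comment> \<open>A small negative multiple of \<open>w\<close>, for which the linear term of the quadratic dominates.\<close>
    define t where "t = - ((w \<bullet> w) / c)"
    have c: "c > 0" by (simp add: c_def)
    have "0 \<le> 2 * t * (w \<bullet> w) + t\<^sup>2 * c"
    proof -
      have "t\<^sup>2 * (k * (w \<bullet> w) - w \<bullet> (A *v w)) \<le> t\<^sup>2 * c"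
        by (rule mult_left_mono) (auto simp: c_def)
      then show ?thesis using quad[of t] by linarith
    qed
    also have "\<dots> = - ((w \<bullet> w)\<^sup>2 / c)"
      using c by (simp add: t_def power2_eq_square field_simps)
    finally show False using pos c by (simp add: field_simps)
  qed
  then have "A *v v = k *\<^sub>R v" by (simp add: w_def)
  then show ?thesis
    using vS vn by (auto simp: S_def orthogonal_def)
qed

lemma orthonormal_eigenvectors_exist:
  fixes A :: "real ^ 'n ^ 'n::finite"
  assumes sym: "transpose A = A" and "k \<le> CARD('n)"
  shows "\<exists>B. finite B \<and> card B = k \<and> pairwise orthogonal B \<and>
           (\<forall>b\<in>B. norm b = 1 \<and> (\<exists>c. A *v b = c *\<^sub>R b))"
  using assms(2)
proof (induction k)
  case 0
  show ?case by (intro exI[of _ "{}"]) simp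
next
  case (Suc k)
  from Suc.prems have "k \<le> CARD('n)" by simp
  from Suc.IH[OF this] obtain B where B: "finite B" "card B = k" "pairwise orthogonal B"
    "\<And>b. b \<in> B \<Longrightarrow> norm b = 1" "\<And>b. b \<in> B \<Longrightarrow> \<exists>c. A *v b = c *\<^sub>R b"
    by blast
  have "card B < CARD('n)" using Suc.prems B(2) by simp
  from orthonormal_eigenvectors_extend[OF sym B(1) this B(5)]
  obtain v c where v: "norm v = 1" "\<forall>b\<in>B. orthogonal b v" "A *v v = c *\<^sub>R v"
    by blast
  have "v \<notin> B"
  proof
    assume "v \<in> B"
    then have "orthogonal v v" using v(2) by blast
    then show False using v(1) by (simp add: orthogonal_self)
  qed
  with B v show ?case
    by (intro exI[of _ "insert v B"])
      (auto simp: pairwise_insert orthogonal_commute)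
qed

lemma matrix_mult_diag_right: "((A :: real ^ 'n ^ 'n::finite) ** diag d) $ i $ j = A $ i $ j * d $ j"
proof -
  have "(A ** diag d) $ i $ j = (\<Sum>k\<in>UNIV. if k = j then A $ i $ k * d $ k else 0)"
    by (simp add: matrix_matrix_mult_def diag_def if_distrib cong: if_cong)
  then show ?thesis by simp
qed

lemma matrix_mult_diag_left: "(diag d ** (A :: real ^ 'n ^ 'n::finite)) $ i $ j = d $ i * A $ i $ j"
proof -
  have "(diag d ** A) $ i $ j = (\<Sum>k\<in>UNIV. if i = k then d $ i * A $ k $ j else 0)"
    by (simp add: matrix_matrix_mult_def diag_def mult_delta_left)
  then show ?thesis by simp
qed

lemma diag_mult_vec: "(diag d *v x) $ i = d $ i * x $ i"
proof -
  have "(diag d *v x) $ i = (\<Sum>k\<in>UNIV. if i = k then d $ i * x $ k else 0)"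
    by (simp add: matrix_vector_mult_def diag_def mult_delta_left)
  then show ?thesis by simp
qed

lemma spectral_decomposition:
  fixes A :: "real ^ 'n ^ 'n::finite"
  assumes sym: "transpose A = A"
  obtains U d where "orthogonal_matrix U" "A = U ** diag d ** transpose U"
proof -
  obtain B where B: "finite B" "card B = CARD('n)" "pairwise orthogonal B"
    "\<And>b. b \<in> B \<Longrightarrow> norm b = 1" "\<And>b. b \<in> B \<Longrightarrow> \<exists>c. A *v b = c *\<^sub>R b"
    using orthonormal_eigenvectors_exist[OF sym order.refl] by blast
  then obtain f :: "'n \<Rightarrow> real ^ 'n" where f: "bij_betw f UNIV B"
    using finite_same_card_bij[of "UNIV :: 'n set" B] by auto
  then have fB: "f j \<in> B" for j by (auto simp: bij_betw_def)
  define c where "c j = (SOME k. A *v f j = k *\<^sub>R f j)" for j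
  have c: "A *v f j = c j *\<^sub>R f j" for j
    unfolding c_def by (rule someI_ex) (rule B(5)[OF fB])
  define U :: "real ^ 'n ^ 'n" where "U = (\<chi> i j. f j $ i)"
  have col: "column j U = f j" for j by (simp add: U_def column_def vec_eq_iff)
  have U: "orthogonal_matrix U"
    unfolding orthogonal_matrix_orthonormal_columns
    using B(3) B(4)[OF fB] fB f
    by (auto simp: col bij_betw_def inj_on_def intro!: pairwiseD[OF B(3)])
  have "A ** U = U ** diag (\<chi> j. c j)"
  proof -
    have "(A ** U) $ i $ j = (A *v f j) $ i" for i j
      by (simp add: matrix_matrix_mult_def matrix_vector_mult_def U_def)
    then show ?thesis by (simp add: vec_eq_iff matrix_mult_diag_right c U_def)
  qed
  then have "U ** diag (\<chi> j. c j) ** transpose U = A ** (U ** transpose U)"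
    by (simp add: matrix_mul_assoc)
  also have "\<dots> = A" using U by (simp add: orthogonal_matrix_def)
  finally have eq: "U ** diag (\<chi> j. c j) ** transpose U = A" .
  show ?thesis by (rule that[OF U eq[symmetric]])
qed

text \<open>
  Uniqueness of the absolute value: two orthogonal diagonalizations of \<open>A\<close> differ by an orthogonal
  \<open>W\<close> that intertwines \<open>diag d\<close> and \<open>diag d'\<close>. So \<open>W\<close> has a nonzero entry only where the two
  eigenvalues agree, and there their absolute values agree too.
\<close>
lemma matrix_abs_eq:
  fixes A :: "real ^ 'n ^ 'n::finite"
  assumes U: "orthogonal_matrix U" and A: "A = U ** diag d ** transpose U"
  shows "matrix_abs A = U ** diag (\<chi> i. \<bar>d $ i\<bar>) ** transpose U"
  unfolding matrix_abs_def
proof (rule the_equality)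
  show "\<exists>U' d'. orthogonal_matrix U' \<and> A = U' ** diag d' ** transpose U' \<and>
     U ** diag (\<chi> i. \<bar>d $ i\<bar>) ** transpose U = U' ** diag (\<chi> i. \<bar>d' $ i\<bar>) ** transpose U'"
    using assms by blast
next
  fix B
  assume "\<exists>U d. orthogonal_matrix U \<and> A = U ** diag d ** transpose U \<and>
     B = U ** diag (\<chi> i. \<bar>d $ i\<bar>) ** transpose U"
  then obtain U' d' where U': "orthogonal_matrix U'" and A': "A = U' ** diag d' ** transpose U'"
    and B: "B = U' ** diag (\<chi> i. \<bar>d' $ i\<bar>) ** transpose U'" by blast
  note UU = U[unfolded orthogonal_matrix_def] and UU' = U'[unfolded orthogonal_matrix_def]
  define W where "W = transpose U ** U'"
  have "diag d ** W = transpose U ** (U ** diag d ** transpose U) ** U'"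
    using UU by (simp add: W_def matrix_mul_assoc)
  also have "\<dots> = transpose U ** (U' ** diag d' ** transpose U') ** U'"
    using A A' by simp
  also have "\<dots> = W ** diag d'"
    using UU' by (simp add: W_def matrix_mul_assoc[symmetric])
  finally have DW: "diag d ** W = W ** diag d'" .
  have comm: "d $ i * W $ i $ j = W $ i $ j * d' $ j" for i j
    using arg_cong[OF DW, of "\<lambda>X. X $ i $ j"] by (simp only: matrix_mult_diag_left matrix_mult_diag_right)
  have "W $ i $ j * \<bar>d' $ j\<bar> = \<bar>d $ i\<bar> * W $ i $ j" for i j
    using comm[of i j] by (cases "W $ i $ j = 0") auto
  then have comm': "W ** diag (\<chi> i. \<bar>d' $ i\<bar>) = diag (\<chi> i. \<bar>d $ i\<bar>) ** W"
    unfolding vec_eq_iff matrix_mult_diag_left matrix_mult_diag_right by simp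
  have "U ** W = U'" using UU by (simp add: W_def matrix_mul_assoc)
  then have "B = U ** (W ** diag (\<chi> i. \<bar>d' $ i\<bar>)) ** transpose U'"
    by (simp add: B matrix_mul_assoc)
  also have "\<dots> = U ** diag (\<chi> i. \<bar>d $ i\<bar>) ** (W ** transpose U')"
    by (simp add: comm' matrix_mul_assoc)
  also have "W ** transpose U' = transpose U"
    using UU' by (simp add: W_def matrix_mul_assoc[symmetric])
  finally show "B = U ** diag (\<chi> i. \<bar>d $ i\<bar>) ** transpose U" .
qed

lemma quadratic_form_diagonalized:
  fixes U :: "real ^ 'n ^ 'n::finite"
  shows "x \<bullet> ((U ** diag d ** transpose U) *v x) = (\<Sum>i\<in>UNIV. d $ i * ((transpose U *v x) $ i)\<^sup>2)"
proof -
  have "x \<bullet> ((U ** diag d ** transpose U) *v x) = (transpose U *v x) \<bullet> (diag d *v (transpose U *v x))"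
    by (simp only: matrix_vector_mul_assoc[symmetric] inner_matrix_vector_mult[of x U])
  also have "\<dots> = (\<Sum>i\<in>UNIV. d $ i * ((transpose U *v x) $ i)\<^sup>2)"
    by (simp add: inner_vec_def diag_mult_vec power2_eq_square mult_ac)
  finally show ?thesis .
qed

lemma det_one_minus_diagonalized:
  fixes U :: "real ^ 'n ^ 'n::finite"
  assumes U: "orthogonal_matrix U"
  shows "det (mat 1 - c *\<^sub>R (U ** diag d ** transpose U)) = (\<Prod>i\<in>UNIV. 1 - c * d $ i)"
proof -
  have D: "mat 1 - c *\<^sub>R diag d = diag (\<chi> i. 1 - c * d $ i)"
    by (simp add: vec_eq_iff mat_def diag_def)
  have "U ** diag (\<chi> i. 1 - c * d $ i) ** transpose U
      = U ** transpose U - c *\<^sub>R (U ** diag d ** transpose U)"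
    by (simp add: vec_eq_iff matrix_matrix_mult_def[of _ "transpose U"] matrix_mult_diag_right
        sum_distrib_left algebra_simps flip: sum_subtractf)
  also have "U ** transpose U = mat 1" using U by (simp add: orthogonal_matrix_def)
  finally have E: "U ** diag (\<chi> i. 1 - c * d $ i) ** transpose U
      = mat 1 - c *\<^sub>R (U ** diag d ** transpose U)" .
  have "det (mat 1 - c *\<^sub>R (U ** diag d ** transpose U))
      = det U * det (diag (\<chi> i. 1 - c * d $ i)) * det (transpose U)"
    unfolding E[symmetric] by (simp only: det_mul)
  also have "\<dots> = det (U ** transpose U) * det (diag (\<chi> i. 1 - c * d $ i))"
    by (simp add: det_mul)
  also have "\<dots> = det (diag (\<chi> i. 1 - c * d $ i))"
    using U by (simp add: orthogonal_matrix_def)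
  also have "\<dots> = (\<Prod>i\<in>UNIV. 1 - c * d $ i)"
    by (subst det_diagonal) (auto simp: diag_def)
  finally show ?thesis .
qed

lemma map_matrix_of_real_mult:
  "map_matrix complex_of_real (A ** B) = map_matrix complex_of_real A ** map_matrix complex_of_real B"
  by (simp add: vec_eq_iff map_matrix_def matrix_matrix_mult_def)

text \<open>
  With \<open>L = diag l\<close>, the matrices \<open>D L\<^sup>2\<close> and \<open>L D L\<close> are similar, so the spectrum of the former is real and
  its spectral radius can be read off a spectral decomposition of the latter.
\<close>
lemma spectral_rad_eq_Max:
  fixes D :: "real ^ 'n ^ 'n::finite"
  assumes l: "\<And>i. l $ i > 0" and U: "orthogonal_matrix U"
    and dec: "diag l ** D ** diag l = U ** diag d ** transpose U"
  shows "spectral_rad (D ** (diag l ** diag l)) = Max (range (\<lambda>i. \<bar>d $ i\<bar>))"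
proof -
  note UU = U[unfolded orthogonal_matrix_def]
  let ?c = "map_matrix complex_of_real"
  let ?E = "{k :: complex. \<exists>v. v \<noteq> 0 \<and> ?c (D ** (diag l ** diag l)) *v v = k *s v}"
  define li where "li = (\<chi> i. 1 / l $ i)"
  have l0: "l $ i \<noteq> 0" for i using l[of i] by simp
  have lli: "diag l ** diag li = mat 1" "diag li ** diag l = mat 1"
    using l0 by (auto simp: vec_eq_iff matrix_mult_diag_left mat_def li_def) (simp_all add: diag_def)
  have c1: "?c (mat 1) = mat 1" by (auto simp: vec_eq_iff map_matrix_def mat_def)
  define R where "R = transpose U ** diag l"
  define Ri where "Ri = diag li ** U"
  have "R ** Ri = transpose U ** (diag l ** diag li) ** U" "Ri ** R = diag li ** (U ** transpose U) ** diag l"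
    by (simp_all only: R_def Ri_def matrix_mul_assoc)
  then have RR: "R ** Ri = mat 1" "Ri ** R = mat 1"
    using UU by (simp_all add: lli)
  have RD: "R ** (D ** (diag l ** diag l)) = diag d ** R"
  proof -
    have "R ** (D ** (diag l ** diag l)) = transpose U ** (diag l ** D ** diag l) ** diag l"
      by (simp add: R_def matrix_mul_assoc)
    also have "\<dots> = (transpose U ** U) ** diag d ** R"
      unfolding dec R_def by (simp add: matrix_mul_assoc)
    finally show ?thesis using UU by simp
  qed
  have diagc: "(?c (diag d) *v x) $ i = of_real (d $ i) * x $ i" for x i
  proof -
    have "(?c (diag d) *v x) $ i = (\<Sum>k\<in>UNIV. if i = k then of_real (d $ i) * x $ k else 0)"
      by (simp add: matrix_vector_mult_def diag_def map_matrix_def mult_delta_left if_distrib[of complex_of_real] cong: if_cong)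
    then show ?thesis by simp
  qed
  have "?E = range (\<lambda>i. complex_of_real (d $ i))"
  proof (intro equalityI subsetI)
    fix k assume "k \<in> ?E"
    then obtain v where v: "v \<noteq> 0" "?c (D ** (diag l ** diag l)) *v v = k *s v" by blast
    define x where "x = ?c R *v v"
    have "?c Ri *v x = v"
      by (simp add: x_def matrix_vector_mul_assoc RR c1 flip: map_matrix_of_real_mult)
    then have "x \<noteq> 0" using v(1) by auto
    then obtain i where i: "x $ i \<noteq> 0" by (auto simp: vec_eq_iff)
    have "?c (diag d) *v x = ?c R *v (?c (D ** (diag l ** diag l)) *v v)"
      by (simp add: x_def matrix_vector_mul_assoc RD flip: map_matrix_of_real_mult)
    also have "\<dots> = k *s x"
      by (simp add: v(2) x_def vector_scalar_commute)
    finally have dx: "?c (diag d) *v x = k *s x" .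
    have "of_real (d $ i) * x $ i = k * x $ i"
      using arg_cong[OF dx, of "\<lambda>v. v $ i"] by (simp only: diagc vector_smult_component)
    then show "k \<in> range (\<lambda>i. complex_of_real (d $ i))" using i by auto
  next
    fix k assume "k \<in> range (\<lambda>i. complex_of_real (d $ i))"
    then obtain i where k: "k = of_real (d $ i)" by blast
    define x :: "complex ^ 'n" where "x = axis i 1"
    define v where "v = ?c Ri *v x"
    have Rv: "?c R *v v = x"
      by (simp add: v_def matrix_vector_mul_assoc RR c1 flip: map_matrix_of_real_mult)
    have "v \<noteq> 0"
      using Rv by (auto simp: x_def)
    have D': "D ** (diag l ** diag l) = Ri ** diag d ** R"
    proof -
      have "D ** (diag l ** diag l) = (Ri ** R) ** (D ** (diag l ** diag l))"
        by (simp only: RR(2) matrix_mul_lid)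
      also have "\<dots> = Ri ** (R ** (D ** (diag l ** diag l)))"
        by (simp only: matrix_mul_assoc)
      also have "\<dots> = Ri ** diag d ** R"
        unfolding RD by (simp only: matrix_mul_assoc)
      finally show ?thesis .
    qed
    have "?c (diag d) *v x = k *s x"
      by (simp add: vec_eq_iff diagc k x_def axis_def)
    then have "?c (D ** (diag l ** diag l)) *v v = k *s v"
      by (simp add: D' map_matrix_of_real_mult Rv v_def vector_scalar_commute
          flip: matrix_vector_mul_assoc) (simp add: Rv v_def[symmetric] vector_scalar_commute)
    then show "k \<in> ?E" using \<open>v \<noteq> 0\<close> by blast
  qed
  then have "norm ` ?E = range (\<lambda>i. \<bar>d $ i\<bar>)"
    by (simp add: image_image)
  then show ?thesis by (simp add: spectral_rad_def)
qed

section \<open>Gaussian integrals\<close>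

abbreviation gaussian :: "real measure" where
  "gaussian \<equiv> std_normal_distribution"

lemma prob_space_gaussian: "prob_space gaussian"
  by (simp add: prob_space_normal_density)

lemma integral_gaussian:
  fixes f :: "real \<Rightarrow> real"
  assumes "f \<in> borel_measurable borel"
  shows "(\<integral>x. f x \<partial>gaussian) = (\<integral>x. std_normal_density x * f x \<partial>lborel)"
  using assms by (simp add: integral_real_density)

lemma integrable_gaussian_iff:
  fixes f :: "real \<Rightarrow> real"
  assumes "f \<in> borel_measurable borel"
  shows "integrable gaussian f \<longleftrightarrow> integrable lborel (\<lambda>x. std_normal_density x * f x)"
  using assms by (simp add: integrable_real_density)

lemma integrable_gaussian_id: "integrable gaussian (\<lambda>x. x)"
  using integrable_std_normal_moment[of 1] by (subst integrable_gaussian_iff) auto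

lemma integrable_gaussian_abs: "integrable gaussian (\<lambda>x. \<bar>x\<bar>)"
  using integrable_gaussian_id by (rule integrable_abs)

text \<open>
  Completing the square turns the integrand into a multiple of the density with mean \<open>a\<close>.
\<close>
lemma gaussian_exp_linear:
  shows "integrable gaussian (\<lambda>x. exp (a * x))" "(\<integral>x. exp (a * x) \<partial>gaussian) = exp (a\<^sup>2 / 2)"
proof -
  have "std_normal_density x * exp (a * x) = exp (a\<^sup>2 / 2) * normal_density a 1 x" for x
  proof -
    have "a * x - x\<^sup>2 / 2 = a\<^sup>2 / 2 - (x - a)\<^sup>2 / 2"
      by (simp add: power2_eq_square field_simps)
    then show ?thesis
      by (simp add: normal_density_def field_simps flip: exp_add exp_diff)
  qed
  note * = this
  show "integrable gaussian (\<lambda>x. exp (a * x))"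
    by (subst integrable_gaussian_iff) (simp_all add: *)
  show "(\<integral>x. exp (a * x) \<partial>gaussian) = exp (a\<^sup>2 / 2)"
    by (subst integral_gaussian) (simp_all add: *)
qed

text \<open>
  The integrand is a multiple of the centered density with variance \<open>1 / (1 - 2 c)\<close>.
\<close>
lemma gaussian_exp_square:
  assumes "2 * c < 1"
  shows "integrable gaussian (\<lambda>x. exp (c * x\<^sup>2))"
    "(\<integral>x. exp (c * x\<^sup>2) \<partial>gaussian) = (1 - 2 * c) powr (-1/2)"
proof -
  define s where "s = 1 / sqrt (1 - 2 * c)"
  have s: "s > 0" "s\<^sup>2 = 1 / (1 - 2 * c)" using assms by (auto simp: s_def power_divide)
  have "std_normal_density x * exp (c * x\<^sup>2) = s * normal_density 0 s x" for x
  proof -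
    have "s * normal_density 0 s x = (1 / sqrt (2 * pi)) * exp (- (x\<^sup>2 / (2 * s\<^sup>2)))"
      using s(1) by (simp add: normal_density_def real_sqrt_mult)
    also have "- (x\<^sup>2 / (2 * s\<^sup>2)) = - x\<^sup>2 / 2 + c * x\<^sup>2"
      using assms by (simp add: s(2) field_simps)
    finally show ?thesis by (simp add: std_normal_density_def flip: exp_add)
  qed
  note * = this
  show "integrable gaussian (\<lambda>x. exp (c * x\<^sup>2))"
    using s by (subst integrable_gaussian_iff) (simp_all add: *)
  have "s = (1 - 2 * c) powr (-1/2)"
    using assms by (simp add: s_def powr_minus_divide powr_half_sqrt)
  then show "(\<integral>x. exp (c * x\<^sup>2) \<partial>gaussian) = (1 - 2 * c) powr (-1/2)"
    using s by (subst integral_gaussian) (simp_all add: *)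
qed

lemma std_normal_density_tendsto_0:
  "(std_normal_density \<longlongrightarrow> 0) at_top" "(std_normal_density \<longlongrightarrow> 0) at_bot"
proof -
  have "filterlim (\<lambda>x::real. x\<^sup>2 / 2) at_top at_top"
    by (intro filterlim_at_top_mult_tendsto_pos[where f = "\<lambda>_. 1/2", simplified]
        filterlim_pow_at_top filterlim_ident tendsto_const) auto
  then have "((\<lambda>x::real. exp (- (x\<^sup>2 / 2))) \<longlongrightarrow> 0) at_top"
    by (intro filterlim_compose[OF exp_at_bot]) (simp add: filterlim_uminus_at_bot)
  from tendsto_mult_left[OF this, of "1 / sqrt (2 * pi)"]
  show *: "(std_normal_density \<longlongrightarrow> 0) at_top"
    by (simp add: std_normal_density_def[abs_def])
  have "((\<lambda>x. std_normal_density (- x)) \<longlongrightarrow> 0) at_bot"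
    using filterlim_compose[OF * filterlim_uminus_at_top_at_bot] .
  then show "(std_normal_density \<longlongrightarrow> 0) at_bot"
    by (simp add: std_normal_density_def[abs_def])
qed

text \<open>
  The derivative of \<open>f\<close> times the density is \<open>f' x - x f x\<close> times the density, and the product
  vanishes at both ends of the line because \<open>f\<close> is bounded.
\<close>
lemma gaussian_integration_by_parts:
  fixes f f' :: "real \<Rightarrow> real"
  assumes df: "\<And>x. (f has_real_derivative f' x) (at x)"
    and cf': "continuous_on UNIV f'"
    and bf: "\<And>x. \<bar>f x\<bar> \<le> B" and bf': "\<And>x. \<bar>f' x\<bar> \<le> B'"
  shows "(\<integral>x. x * f x \<partial>gaussian) = (\<integral>x. f' x \<partial>gaussian)"
proof -
  interpret prob_space gaussian by (rule prob_space_gaussian)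
  have [measurable]: "f \<in> borel_measurable borel"
    using df by (intro borel_measurable_continuous_onI DERIV_continuous_on)
      (auto intro: DERIV_subset)
  have [measurable]: "f' \<in> borel_measurable borel"
    using cf' by (rule borel_measurable_continuous_onI)
  have i1: "integrable gaussian f'"
    using bf' by (intro integrable_const_bound[of _ B']) auto
  have i2: "integrable gaussian (\<lambda>x. x * f x)"
    by (rule Bochner_Integration.integrable_bound[OF integrable_mult_left[OF integrable_gaussian_abs, of B]])
      (auto simp: abs_mult intro!: AE_I2 mult_left_mono order.trans[OF bf abs_ge_self])
  have [measurable]: "(\<lambda>x. x * f x) \<in> borel_measurable borel" by measurable
  define F' where "F' = (\<lambda>x. std_normal_density x * f' x - std_normal_density x * (x * f x))"
  have "((\<lambda>x. f x * std_normal_density x) has_real_derivative F' x) (at x)" for x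
    unfolding F'_def std_normal_density_def
    by (rule derivative_eq_intros df refl | simp add: algebra_simps)+
  moreover have "continuous_on UNIV f"
    using df by (intro DERIV_continuous_on) (auto intro: DERIV_subset)
  then have "isCont F' x" for x
    using cf' unfolding F'_def std_normal_density_def
    by (intro continuous_intros) (auto simp: continuous_on_eq_continuous_at)
  moreover have iF': "integrable lborel F'"
    unfolding F'_def using i1 i2
    by (intro Bochner_Integration.integrable_diff) (simp_all add: integrable_gaussian_iff)
  moreover have lim: "((\<lambda>x. f x * std_normal_density x) \<longlongrightarrow> 0) G"
    if "(std_normal_density \<longlongrightarrow> 0) G" for G
  proof (rule Lim_null_comparison)
    show "\<forall>\<^sub>F x in G. norm (f x * std_normal_density x) \<le> B * std_normal_density x"
      by (auto simp: abs_mult intro!: always_eventually mult_right_mono bf)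
    show "((\<lambda>x. B * std_normal_density x) \<longlongrightarrow> 0) G"
      using tendsto_mult_left[OF that, of B] by simp
  qed
  ultimately have "(LBINT x=-\<infinity>..\<infinity>. F' x) = 0 - 0"
    by (intro interval_integral_FTC_integrable[where F = "\<lambda>x. f x * std_normal_density x"])
      (auto simp: has_real_derivative_iff_has_vector_derivative set_integrable_def einterval_def
        ereal_tendsto_simps intro!: lim std_normal_density_tendsto_0)
  then have "(\<integral>x. F' x \<partial>lborel) = 0"
    by (simp add: interval_lebesgue_integral_def set_lebesgue_integral_def einterval_def)
  then have "(\<integral>x. std_normal_density x * f' x \<partial>lborel) = (\<integral>x. std_normal_density x * (x * f x) \<partial>lborel)"
    unfolding F'_def using i1 i2 by (subst (asm) Bochner_Integration.integral_diff)
      (simp_all add: integrable_gaussian_iff)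
  then show ?thesis by (simp add: integral_gaussian)
qed

abbreviation gaussian_family :: "'k set \<Rightarrow> ('k \<Rightarrow> real) measure" where
  "gaussian_family K \<equiv> PiM K (\<lambda>_. gaussian)"

lemma prob_space_gaussian_family: "prob_space (gaussian_family K)"
  by (rule prob_space_PiM) (rule prob_space_gaussian)

lemma borel_measurable_gaussian_component:
  "k \<in> K \<Longrightarrow> (\<lambda>x. x k) \<in> borel_measurable (gaussian_family K)"
  using measurable_component_singleton[of k K "\<lambda>_. gaussian"] by simp

lemma integrable_gaussian_component:
  assumes "k \<in> K"
  shows "integrable (gaussian_family K) (\<lambda>x. \<bar>x k\<bar>)"
proof -
  have "integrable (distr (gaussian_family K) gaussian (\<lambda>x. x k)) (\<lambda>x. \<bar>x\<bar>)"
    using assms prob_space_gaussian integrable_gaussian_abs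
    by (subst distr_PiM_component) auto
  then show ?thesis
    by (rule integrable_distr[OF measurable_component_singleton[OF assms]])
qed

lemma gaussian_family_integration_by_parts:
  fixes f f' :: "('k \<Rightarrow> real) \<Rightarrow> real"
  assumes K: "finite K" "k \<in> K"
    and meas: "f \<in> borel_measurable (gaussian_family K)" "f' \<in> borel_measurable (gaussian_family K)"
    and df: "\<And>x y. ((\<lambda>y. f (x(k := y))) has_real_derivative f' (x(k := y))) (at y)"
    and cf': "\<And>x. continuous_on UNIV (\<lambda>y. f' (x(k := y)))"
    and bf: "\<And>x. \<bar>f x\<bar> \<le> B" and bf': "\<And>x. \<bar>f' x\<bar> \<le> B'"
  shows "integrable (gaussian_family K) (\<lambda>x. x k * f x)"
    "(\<integral>x. x k * f x \<partial>gaussian_family K) = (\<integral>x. f' x \<partial>gaussian_family K)"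
proof -
  interpret G: prob_space gaussian by (rule prob_space_gaussian)
  interpret product_prob_space "\<lambda>_ :: 'k. gaussian" UNIV ..
  interpret PK: prob_space "gaussian_family K" by (rule prob_space_gaussian_family)
  note [measurable] = meas borel_measurable_gaussian_component[OF K(2)]
  show i1: "integrable (gaussian_family K) (\<lambda>x. x k * f x)"
    by (rule Bochner_Integration.integrable_bound[OF
          integrable_mult_left[OF integrable_gaussian_component[OF K(2)], of B]])
      (auto simp: abs_mult intro!: AE_I2 mult_left_mono order.trans[OF bf abs_ge_self])
  have i2: "integrable (gaussian_family K) f'"
    using bf' by (intro PK.integrable_const_bound[of _ B']) auto
  have "(\<integral>x. x k * f x \<partial>gaussian_family K)
      = (\<integral>x. (\<integral>y. y * f (x(k := y)) \<partial>gaussian) \<partial>gaussian_family (K - {k}))"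
    using product_integral_insert[of "K - {k}" k "\<lambda>x. x k * f x"] K i1 by (simp add: insert_absorb)
  also have "\<dots> = (\<integral>x. (\<integral>y. f' (x(k := y)) \<partial>gaussian) \<partial>gaussian_family (K - {k}))"
    by (rule Bochner_Integration.integral_cong[OF refl])
      (rule gaussian_integration_by_parts[OF df cf' bf bf'])
  also have "\<dots> = (\<integral>x. f' x \<partial>gaussian_family K)"
    using product_integral_insert[of "K - {k}" k f'] K i2 by (simp add: insert_absorb)
  finally show "(\<integral>x. x k * f x \<partial>gaussian_family K) = (\<integral>x. f' x \<partial>gaussian_family K)" .
qed

text \<open>
  The mean value theorem bounds the difference quotients by \<open>w\<close>, so dominated convergence applies.
\<close>
lemma DERIV_integral:
  fixes G G' :: "real \<Rightarrow> 'a \<Rightarrow> real"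
  assumes dG: "\<And>t x. ((\<lambda>t. G t x) has_real_derivative G' t x) (at t)"
    and iG: "\<And>t. integrable M (G t)" and mG': "\<And>t. G' t \<in> borel_measurable M"
    and w: "integrable M w" and bound: "\<And>t x. \<bar>G' t x\<bar> \<le> w x"
  shows "((\<lambda>t. \<integral>x. G t x \<partial>M) has_real_derivative (\<integral>x. G' t x \<partial>M)) (at t)"
  unfolding DERIV_def tendsto_at_iff_sequentially
proof (intro allI impI)
  fix e :: "nat \<Rightarrow> real" assume e: "\<forall>i. e i \<in> UNIV - {0}" "e \<longlonglongrightarrow> 0"
  have "(\<lambda>i. \<integral>x. (G (t + e i) x - G t x) / e i \<partial>M) \<longlonglongrightarrow> (\<integral>x. G' t x \<partial>M)"
  proof (rule integral_dominated_convergence[where w = w])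
    show "AE x in M. (\<lambda>i. (G (t + e i) x - G t x) / e i) \<longlonglongrightarrow> G' t x"
      using dG e unfolding DERIV_def tendsto_at_iff_sequentially by (auto simp: comp_def)
    show "AE x in M. norm ((G (t + e i) x - G t x) / e i) \<le> w x" for i
    proof (rule AE_I2)
      fix x
      have "norm (G (t + e i) x - G t x) \<le> w x * norm (t + e i - t)"
        by (rule field_differentiable_bound[of UNIV "\<lambda>t. G t x" "\<lambda>t. G' t x"])
          (use dG bound in auto)
      then show "norm ((G (t + e i) x - G t x) / e i) \<le> w x"
        using e(1) by (simp add: field_simps)
    qed
  qed (use iG mG' w in auto)
  then show "((\<lambda>h. ((\<integral>x. G (t + h) x \<partial>M) - (\<integral>x. G t x \<partial>M)) / h) \<circ> e) \<longlonglongrightarrow> (\<integral>x. G' t x \<partial>M)"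
    using iG by (simp add: comp_def)
qed

section \<open>Finite Gibbs measures with Gaussian couplings\<close>

text \<open>
  A Gibbs measure on a finite set \<open>C\<close> of configurations with weights
  \<open>w \<sigma> exp (\<Sum> x\<^sub>k \<phi>\<^sub>k \<sigma>)\<close>, where the functions \<open>\<phi>\<^sub>k\<close> take the values \<open>1\<close> and \<open>-1\<close>. The couplings \<open>x\<close>
  are the quantities that the disorder makes random. The SK Hamiltonian, the random fields and their
  interpolation are all of this form.
\<close>
locale finite_gibbs =
  fixes K :: "'k set" and C :: "'c set" and w :: "'c \<Rightarrow> real" and \<phi> :: "'k \<Rightarrow> 'c \<Rightarrow> real"
  assumes finK: "finite K" and finC: "finite C" and neC: "C \<noteq> {}"
    and w_pos: "\<And>\<sigma>. \<sigma> \<in> C \<Longrightarrow> w \<sigma> > 0"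
    and \<phi>_sq: "\<And>k \<sigma>. k \<in> K \<Longrightarrow> \<sigma> \<in> C \<Longrightarrow> \<phi> k \<sigma> * \<phi> k \<sigma> = 1"
begin

definition weight :: "('k \<Rightarrow> real) \<Rightarrow> 'c \<Rightarrow> real" where
  "weight x \<sigma> = w \<sigma> * exp (\<Sum>k\<in>K. x k * \<phi> k \<sigma>)"

definition Z :: "('k \<Rightarrow> real) \<Rightarrow> real" where
  "Z x = (\<Sum>\<sigma>\<in>C. weight x \<sigma>)"

definition avg :: "('k \<Rightarrow> real) \<Rightarrow> ('c \<Rightarrow> real) \<Rightarrow> real" where
  "avg x f = (\<Sum>\<sigma>\<in>C. weight x \<sigma> / Z x * f \<sigma>)"

abbreviation avg2 :: "('k \<Rightarrow> real) \<Rightarrow> ('c \<Rightarrow> 'c \<Rightarrow> real) \<Rightarrow> real" where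
  "avg2 x f \<equiv> avg x (\<lambda>\<sigma>. avg x (f \<sigma>))"

lemma weight_pos: "\<sigma> \<in> C \<Longrightarrow> weight x \<sigma> > 0"
  by (simp add: weight_def w_pos)

lemma Z_pos: "Z x > 0"
  unfolding Z_def using finC neC by (intro sum_pos weight_pos) auto

lemma abs_\<phi>: "k \<in> K \<Longrightarrow> \<sigma> \<in> C \<Longrightarrow> \<bar>\<phi> k \<sigma>\<bar> = 1"
  using \<phi>_sq[of k \<sigma>] by (auto simp: square_eq_1_iff)

lemma avg_cong: "(\<And>\<sigma>. \<sigma> \<in> C \<Longrightarrow> f \<sigma> = g \<sigma>) \<Longrightarrow> avg x f = avg x g"
  unfolding avg_def by (intro sum.cong) auto

lemma avg_add: "avg x (\<lambda>\<sigma>. f \<sigma> + g \<sigma>) = avg x f + avg x g"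
  by (simp add: avg_def distrib_left sum.distrib)

lemma avg_diff: "avg x (\<lambda>\<sigma>. f \<sigma> - g \<sigma>) = avg x f - avg x g"
  by (simp add: avg_def right_diff_distrib sum_subtractf)

lemma avg_minus: "avg x (\<lambda>\<sigma>. - f \<sigma>) = - avg x f"
  by (simp add: avg_def sum_negf)

lemma avg_cmult: "avg x (\<lambda>\<sigma>. a * f \<sigma>) = a * avg x f"
  by (simp add: avg_def sum_distrib_left mult_ac)

lemma avg_cmult_right: "avg x (\<lambda>\<sigma>. f \<sigma> * a) = avg x f * a"
  by (simp add: avg_def sum_distrib_left mult_ac)

lemma avg_sum: "avg x (\<lambda>\<sigma>. \<Sum>i\<in>I. f i \<sigma>) = (\<Sum>i\<in>I. avg x (f i))"
  unfolding avg_def by (subst sum.swap) (simp add: sum_distrib_left)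

lemma avg_const: "avg x (\<lambda>_. a) = a"
proof -
  have "avg x (\<lambda>_. a) = Z x / Z x * a"
    by (simp only: avg_def Z_def sum_divide_distrib sum_distrib_right)
  then show ?thesis using Z_pos[of x] by simp
qed

lemma avg_swap: "avg x (\<lambda>\<sigma>. avg x (f \<sigma>)) = avg x (\<lambda>\<tau>. avg x (\<lambda>\<sigma>. f \<sigma> \<tau>))"
  unfolding avg_def sum_distrib_left by (subst sum.swap) (simp add: mult_ac)

lemma avg_mono: "(\<And>\<sigma>. \<sigma> \<in> C \<Longrightarrow> f \<sigma> \<le> g \<sigma>) \<Longrightarrow> avg x f \<le> avg x g"
  unfolding avg_def using weight_pos Z_pos
  by (intro sum_mono mult_left_mono divide_nonneg_pos) (auto intro: less_imp_le)

lemma avg_abs_le: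
  assumes "\<And>\<sigma>. \<sigma> \<in> C \<Longrightarrow> \<bar>f \<sigma>\<bar> \<le> B"
  shows "\<bar>avg x f\<bar> \<le> B"
proof -
  have "f \<sigma> \<le> B" "- B \<le> f \<sigma>" if "\<sigma> \<in> C" for \<sigma>
    using assms[OF that] by linarith+
  then have "avg x f \<le> avg x (\<lambda>_. B)" "avg x (\<lambda>_. - B) \<le> avg x f"
    by (intro avg_mono; simp)+
  then show ?thesis by (simp add: avg_const abs_le_iff)
qed

lemmas avg_linear = avg_add avg_diff avg_minus avg_cmult avg_cmult_right avg_const

text \<open>
  Along a path of couplings, the derivative of a Gibbs average is the average of the derivative
  of the observable plus a covariance with the derivative of the energy.
\<close>
lemma DERIV_avg:
  assumes dx: "\<And>k. k \<in> K \<Longrightarrow> ((\<lambda>t. x t k) has_real_derivative x' k) (at t)"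
    and df: "\<And>\<sigma>. \<sigma> \<in> C \<Longrightarrow> ((\<lambda>t. f t \<sigma>) has_real_derivative f' \<sigma>) (at t)"
  shows "((\<lambda>t. avg (x t) (f t)) has_real_derivative
     avg (x t) (\<lambda>\<sigma>. f' \<sigma> + f t \<sigma> * (\<Sum>k\<in>K. x' k * (\<phi> k \<sigma> - avg (x t) (\<phi> k))))) (at t)"
proof -
  define S where "S \<sigma> = (\<Sum>k\<in>K. x' k * \<phi> k \<sigma>)" for \<sigma>
  have dW: "((\<lambda>t. weight (x t) \<sigma>) has_real_derivative weight (x t) \<sigma> * S \<sigma>) (at t)" for \<sigma>
    unfolding weight_def S_def
    by (rule derivative_eq_intros DERIV_sum dx refl | assumption | simp)+
  have dZ: "((\<lambda>t. Z (x t)) has_real_derivative Z (x t) * avg (x t) S) (at t)"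
  proof -
    have "Z (x t) * avg (x t) S = (\<Sum>\<sigma>\<in>C. weight (x t) \<sigma> * S \<sigma>)"
      using Z_pos[of "x t"] by (simp add: avg_def sum_distrib_left)
    then show ?thesis unfolding Z_def by (auto intro!: DERIV_sum dW)
  qed
  have "((\<lambda>t. avg (x t) (f t)) has_real_derivative
     (\<Sum>\<sigma>\<in>C. weight (x t) \<sigma> / Z (x t) * (f' \<sigma> + f t \<sigma> * (S \<sigma> - avg (x t) S)))) (at t)"
    unfolding avg_def[of "x _" "f _"]
  proof (rule DERIV_sum)
    fix \<sigma> assume \<sigma>: "\<sigma> \<in> C"
    have "((\<lambda>t. weight (x t) \<sigma> / Z (x t) * f t \<sigma>) has_real_derivative
        (weight (x t) \<sigma> * S \<sigma> * Z (x t) - weight (x t) \<sigma> * (Z (x t) * avg (x t) S)) / (Z (x t) * Z (x t)) * f t \<sigma>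
         + weight (x t) \<sigma> / Z (x t) * f' \<sigma>) (at t)"
      by (rule derivative_eq_intros dW dZ df[OF \<sigma>] refl | use Z_pos[of "x t"] in simp)+
    also have "(weight (x t) \<sigma> * S \<sigma> * Z (x t) - weight (x t) \<sigma> * (Z (x t) * avg (x t) S)) / (Z (x t) * Z (x t)) * f t \<sigma>
         + weight (x t) \<sigma> / Z (x t) * f' \<sigma>
       = weight (x t) \<sigma> / Z (x t) * (f' \<sigma> + f t \<sigma> * (S \<sigma> - avg (x t) S))"
      using Z_pos[of "x t"] by (simp add: field_simps)
    finally show "((\<lambda>t. weight (x t) \<sigma> / Z (x t) * f t \<sigma>) has_real_derivative
        weight (x t) \<sigma> / Z (x t) * (f' \<sigma> + f t \<sigma> * (S \<sigma> - avg (x t) S))) (at t)" .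
  qed
  moreover have "S \<sigma> - avg (x t) S = (\<Sum>k\<in>K. x' k * (\<phi> k \<sigma> - avg (x t) (\<phi> k)))" for \<sigma>
    unfolding S_def[abs_def] avg_sum avg_cmult by (simp add: right_diff_distrib sum_subtractf)
  ultimately show ?thesis by (simp add: avg_def)
qed

lemma DERIV_avg2:
  assumes dx: "\<And>k. k \<in> K \<Longrightarrow> ((\<lambda>t. x t k) has_real_derivative x' k) (at t)"
    and df: "\<And>\<sigma> \<tau>. \<sigma> \<in> C \<Longrightarrow> \<tau> \<in> C \<Longrightarrow> ((\<lambda>t. f t \<sigma> \<tau>) has_real_derivative f' \<sigma> \<tau>) (at t)"
  shows "((\<lambda>t. avg2 (x t) (f t)) has_real_derivative
     avg2 (x t) (\<lambda>\<sigma> \<tau>. f' \<sigma> \<tau> + f t \<sigma> \<tau> *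
       (\<Sum>k\<in>K. x' k * (\<phi> k \<sigma> + \<phi> k \<tau> - 2 * avg (x t) (\<phi> k))))) (at t)"
proof -
  let ?m = "\<lambda>k. avg (x t) (\<phi> k)"
  have sums: "(\<Sum>k\<in>K. x' k * (\<phi> k \<sigma> + \<phi> k \<tau> - 2 * ?m k))
      = (\<Sum>k\<in>K. x' k * (\<phi> k \<tau> - ?m k)) + (\<Sum>k\<in>K. x' k * (\<phi> k \<sigma> - ?m k))" for \<sigma> \<tau>
    by (simp add: algebra_simps flip: sum.distrib)
  have "((\<lambda>t. avg2 (x t) (f t)) has_real_derivative
     avg (x t) (\<lambda>\<sigma>. avg (x t) (\<lambda>\<tau>. f' \<sigma> \<tau> + f t \<sigma> \<tau> * (\<Sum>k\<in>K. x' k * (\<phi> k \<tau> - ?m k)))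
        + avg (x t) (f t \<sigma>) * (\<Sum>k\<in>K. x' k * (\<phi> k \<sigma> - ?m k)))) (at t)"
    by (rule DERIV_avg[OF dx DERIV_avg[OF dx df]])
  also have "avg (x t) (\<lambda>\<sigma>. avg (x t) (\<lambda>\<tau>. f' \<sigma> \<tau> + f t \<sigma> \<tau> * (\<Sum>k\<in>K. x' k * (\<phi> k \<tau> - ?m k)))
        + avg (x t) (f t \<sigma>) * (\<Sum>k\<in>K. x' k * (\<phi> k \<sigma> - ?m k)))
      = avg2 (x t) (\<lambda>\<sigma> \<tau>. f' \<sigma> \<tau> + f t \<sigma> \<tau> *
       (\<Sum>k\<in>K. x' k * (\<phi> k \<sigma> + \<phi> k \<tau> - 2 * ?m k)))"
    unfolding avg_cmult_right[symmetric] avg_add[symmetric]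
    by (rule arg_cong[where f = "avg (x t)"], rule ext, rule arg_cong[where f = "avg (x t)"], rule ext)
      (simp add: sums distrib_left)
  finally show ?thesis .
qed

text \<open>
  First and second partial derivatives in the coupling \<open>k\<close> of the average of \<open>f\<close> over two replicas
  \<open>\<sigma>\<close>, \<open>\<tau>\<close>. The second one brings in two fresh replicas \<open>\<rho>\<close>, \<open>\<pi>\<close>; its coefficients
  \<open>2 - 4 - 4 + 6\<close> add up to \<open>0\<close>. The value \<open>\<phi>\<^sub>k\<^sup>2 = 1\<close> has been used to cancel the terms with a
  repeated replica.
\<close>
definition grad :: "'k \<Rightarrow> ('c \<Rightarrow> 'c \<Rightarrow> real) \<Rightarrow> ('k \<Rightarrow> real) \<Rightarrow> real" where
  "grad k f x = avg2 x (\<lambda>\<sigma> \<tau>. f \<sigma> \<tau> * (\<phi> k \<sigma> + \<phi> k \<tau> - 2 * avg x (\<phi> k)))"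

definition hess :: "'k \<Rightarrow> ('c \<Rightarrow> 'c \<Rightarrow> real) \<Rightarrow> ('k \<Rightarrow> real) \<Rightarrow> real" where
  "hess k f x = avg2 x (\<lambda>\<sigma> \<tau>. avg2 x (\<lambda>\<rho> \<pi>. f \<sigma> \<tau> *
     (2 * (\<phi> k \<sigma> * \<phi> k \<tau>) - 4 * (\<phi> k \<sigma> * \<phi> k \<rho>) - 4 * (\<phi> k \<tau> * \<phi> k \<rho>) + 6 * (\<phi> k \<rho> * \<phi> k \<pi>))))"

lemma hess_alt:
  "hess k f x = avg2 x (\<lambda>\<sigma> \<tau>. f \<sigma> \<tau> *
     (2 * (\<phi> k \<sigma> * \<phi> k \<tau>) - 4 * (\<phi> k \<sigma> * avg x (\<phi> k)) - 4 * (\<phi> k \<tau> * avg x (\<phi> k)) + 6 * (avg x (\<phi> k) * avg x (\<phi> k))))"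
  unfolding hess_def by (simp add: avg_linear)

lemma DERIV_grad_coordinate:
  assumes k: "k \<in> K"
  shows "((\<lambda>y. grad k f (\<lambda>l. a l * (x(k := y)) l)) has_real_derivative
     a k * hess k f (\<lambda>l. a l * (x(k := y)) l)) (at y)"
proof -
  define X where "X y = (\<lambda>l. a l * (x(k := y)) l)" for y
  define X' where "X' l = (if l = k then a k else 0)" for l
  define m where "m = avg (X y) (\<phi> k)"
  have dX: "((\<lambda>y. X y l) has_real_derivative X' l) (at y)" for l
  proof (cases "l = k")
    case True
    show ?thesis unfolding X_def X'_def True by (auto intro!: derivative_eq_intros)
  qed (simp add: X_def X'_def)
  have sumX': "(\<Sum>l\<in>K. X' l * u l) = a k * u k" for u
    using finK k by (simp add: X'_def mult_delta_left)
  have "((\<lambda>y. avg (X y) (\<phi> k)) has_real_derivative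
      avg (X y) (\<lambda>\<sigma>. 0 + \<phi> k \<sigma> * (\<Sum>l\<in>K. X' l * (\<phi> l \<sigma> - avg (X y) (\<phi> l))))) (at y)"
    by (rule DERIV_avg[OF dX DERIV_const])
  also have "avg (X y) (\<lambda>\<sigma>. 0 + \<phi> k \<sigma> * (\<Sum>l\<in>K. X' l * (\<phi> l \<sigma> - avg (X y) (\<phi> l))))
      = avg (X y) (\<lambda>\<sigma>. a k * 1 - a k * (\<phi> k \<sigma> * m))"
  proof (rule avg_cong)
    fix \<sigma> assume "\<sigma> \<in> C"
    have "\<phi> k \<sigma> * (a k * (\<phi> k \<sigma> - m)) = a k * (\<phi> k \<sigma> * \<phi> k \<sigma>) - a k * (\<phi> k \<sigma> * m)"
      by (simp add: algebra_simps)
    then show "0 + \<phi> k \<sigma> * (\<Sum>l\<in>K. X' l * (\<phi> l \<sigma> - avg (X y) (\<phi> l)))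
      = a k * 1 - a k * (\<phi> k \<sigma> * m)"
      using \<phi>_sq[OF k \<open>\<sigma> \<in> C\<close>] by (simp only: sumX' m_def add_0)
  qed
  also have "\<dots> = a k * (1 - m * m)"
    by (simp only: avg_linear) (simp add: m_def algebra_simps)
  finally have dm: "((\<lambda>y. avg (X y) (\<phi> k)) has_real_derivative a k * (1 - m * m)) (at y)" .
  have "((\<lambda>y. grad k f (X y)) has_real_derivative
      avg2 (X y) (\<lambda>\<sigma> \<tau>. f \<sigma> \<tau> * (- 2 * (a k * (1 - m * m)))
        + f \<sigma> \<tau> * (\<phi> k \<sigma> + \<phi> k \<tau> - 2 * avg (X y) (\<phi> k)) *
         (\<Sum>l\<in>K. X' l * (\<phi> l \<sigma> + \<phi> l \<tau> - 2 * avg (X y) (\<phi> l))))) (at y)"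
    unfolding grad_def
    by (rule DERIV_avg2[OF dX]) (rule derivative_eq_intros dm refl | simp)+
  also have "avg2 (X y) (\<lambda>\<sigma> \<tau>. f \<sigma> \<tau> * (- 2 * (a k * (1 - m * m)))
        + f \<sigma> \<tau> * (\<phi> k \<sigma> + \<phi> k \<tau> - 2 * avg (X y) (\<phi> k)) *
         (\<Sum>l\<in>K. X' l * (\<phi> l \<sigma> + \<phi> l \<tau> - 2 * avg (X y) (\<phi> l))))
      = avg2 (X y) (\<lambda>\<sigma> \<tau>. a k * (f \<sigma> \<tau> *
     (2 * (\<phi> k \<sigma> * \<phi> k \<tau>) - 4 * (\<phi> k \<sigma> * m) - 4 * (\<phi> k \<tau> * m) + 6 * (m * m))))"
  proof (intro avg_cong)
    fix \<sigma> \<tau> assume C: "\<sigma> \<in> C" "\<tau> \<in> C"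
    have "(\<phi> k \<sigma> + \<phi> k \<tau> - 2 * m) * (\<phi> k \<sigma> + \<phi> k \<tau> - 2 * m)
       = \<phi> k \<sigma> * \<phi> k \<sigma> + \<phi> k \<tau> * \<phi> k \<tau> + 2 * (\<phi> k \<sigma> * \<phi> k \<tau>) - 4 * (\<phi> k \<sigma> * m) - 4 * (\<phi> k \<tau> * m) + 4 * (m * m)"
      by (simp add: algebra_simps)
    then have *: "(\<phi> k \<sigma> + \<phi> k \<tau> - 2 * m) * (\<phi> k \<sigma> + \<phi> k \<tau> - 2 * m)
       = 2 + 2 * (\<phi> k \<sigma> * \<phi> k \<tau>) - 4 * (\<phi> k \<sigma> * m) - 4 * (\<phi> k \<tau> * m) + 4 * (m * m)"
      using \<phi>_sq[OF k C(1)] \<phi>_sq[OF k C(2)] by simp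
    have "f \<sigma> \<tau> * (- 2 * (a k * (1 - m * m))) + f \<sigma> \<tau> * (\<phi> k \<sigma> + \<phi> k \<tau> - 2 * m) * (a k * (\<phi> k \<sigma> + \<phi> k \<tau> - 2 * m))
      = a k * (f \<sigma> \<tau> * ((\<phi> k \<sigma> + \<phi> k \<tau> - 2 * m) * (\<phi> k \<sigma> + \<phi> k \<tau> - 2 * m) - 2 + 2 * (m * m)))"
      by (simp add: algebra_simps)
    then show "f \<sigma> \<tau> * (- 2 * (a k * (1 - m * m)))
        + f \<sigma> \<tau> * (\<phi> k \<sigma> + \<phi> k \<tau> - 2 * avg (X y) (\<phi> k)) *
         (\<Sum>l\<in>K. X' l * (\<phi> l \<sigma> + \<phi> l \<tau> - 2 * avg (X y) (\<phi> l)))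
       = a k * (f \<sigma> \<tau> * (2 * (\<phi> k \<sigma> * \<phi> k \<tau>) - 4 * (\<phi> k \<sigma> * m) - 4 * (\<phi> k \<tau> * m) + 6 * (m * m)))"
      unfolding sumX' m_def[symmetric] * by (simp add: algebra_simps)
  qed
  also have "\<dots> = a k * hess k f (X y)"
    by (simp only: hess_alt avg_cmult flip: m_def)
  finally show ?thesis unfolding X_def .
qed

lemma continuous_on_avg:
  assumes "\<And>k. k \<in> K \<Longrightarrow> continuous_on S (\<lambda>t. x t k)"
    and "\<And>\<sigma>. \<sigma> \<in> C \<Longrightarrow> continuous_on S (\<lambda>t. f t \<sigma>)"
  shows "continuous_on S (\<lambda>t. avg (x t) (f t))"
proof -
  have "continuous_on S (\<lambda>t. weight (x t) \<sigma>)" for \<sigma>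
    unfolding weight_def using assms(1) by (intro continuous_intros) auto
  moreover from this have "continuous_on S (\<lambda>t. Z (x t))"
    unfolding Z_def by (intro continuous_intros)
  moreover have "Z (x t) \<noteq> 0" for t using Z_pos[of "x t"] by simp
  ultimately show ?thesis
    unfolding avg_def using assms(2) by (intro continuous_intros) auto
qed

lemma continuous_on_hess:
  assumes "k \<in> K" "\<And>k. k \<in> K \<Longrightarrow> continuous_on S (\<lambda>t. x t k)"
  shows "continuous_on S (\<lambda>t. hess k f (x t))"
  unfolding hess_alt using assms by (intro continuous_on_avg continuous_intros) auto

lemma borel_measurable_avg:
  assumes "\<And>k. k \<in> K \<Longrightarrow> (\<lambda>t. x t k) \<in> borel_measurable M"
    and "\<And>\<sigma>. \<sigma> \<in> C \<Longrightarrow> (\<lambda>t. f t \<sigma>) \<in> borel_measurable M"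
  shows "(\<lambda>t. avg (x t) (f t)) \<in> borel_measurable M"
proof -
  have "(\<lambda>t. weight (x t) \<sigma>) \<in> borel_measurable M" for \<sigma>
    unfolding weight_def using assms(1) by measurable
  moreover from this have "(\<lambda>t. Z (x t)) \<in> borel_measurable M"
    unfolding Z_def by measurable
  ultimately show ?thesis
    unfolding avg_def using assms(2)
    by (intro borel_measurable_sum borel_measurable_times borel_measurable_divide) auto
qed

lemma abs_avg_\<phi>_le: "k \<in> K \<Longrightarrow> \<bar>avg x (\<phi> k)\<bar> \<le> 1"
  by (rule avg_abs_le) (simp add: abs_\<phi>)

lemma abs_grad_le:
  assumes "k \<in> K" and f: "\<And>\<sigma> \<tau>. \<sigma> \<in> C \<Longrightarrow> \<tau> \<in> C \<Longrightarrow> \<bar>f \<sigma> \<tau>\<bar> \<le> B"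
  shows "\<bar>grad k f x\<bar> \<le> B * 4"
  unfolding grad_def
proof (intro avg_abs_le)
  fix \<sigma> \<tau> assume C: "\<sigma> \<in> C" "\<tau> \<in> C"
  have "\<bar>\<phi> k \<sigma> + \<phi> k \<tau> - 2 * avg x (\<phi> k)\<bar> \<le> 4"
    using abs_\<phi>[OF assms(1) C(1)] abs_\<phi>[OF assms(1) C(2)] abs_avg_\<phi>_le[OF assms(1), of x] by linarith
  then show "\<bar>f \<sigma> \<tau> * (\<phi> k \<sigma> + \<phi> k \<tau> - 2 * avg x (\<phi> k))\<bar> \<le> B * 4"
    unfolding abs_mult using f[OF C] by (intro mult_mono) auto
qed

lemma abs_hess_le:
  assumes "k \<in> K" and f: "\<And>\<sigma> \<tau>. \<sigma> \<in> C \<Longrightarrow> \<tau> \<in> C \<Longrightarrow> \<bar>f \<sigma> \<tau>\<bar> \<le> B"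
  shows "\<bar>hess k f x\<bar> \<le> B * 16"
  unfolding hess_def
proof (intro avg_abs_le)
  fix \<sigma> \<tau> \<rho> \<pi> assume C: "\<sigma> \<in> C" "\<tau> \<in> C" "\<rho> \<in> C" "\<pi> \<in> C"
  have 1: "\<bar>\<phi> k \<sigma> * \<phi> k \<tau>\<bar> = 1" if "\<sigma> \<in> C" "\<tau> \<in> C" for \<sigma> \<tau>
    using that assms(1) by (simp add: abs_mult abs_\<phi>)
  have "\<bar>2 * (\<phi> k \<sigma> * \<phi> k \<tau>) - 4 * (\<phi> k \<sigma> * \<phi> k \<rho>) - 4 * (\<phi> k \<tau> * \<phi> k \<rho>) + 6 * (\<phi> k \<rho> * \<phi> k \<pi>)\<bar> \<le> 16"
    using 1[OF C(1,2)] 1[OF C(1,3)] 1[OF C(2,3)] 1[OF C(3,4)] by linarith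
  then show "\<bar>f \<sigma> \<tau> * (2 * (\<phi> k \<sigma> * \<phi> k \<tau>) - 4 * (\<phi> k \<sigma> * \<phi> k \<rho>) - 4 * (\<phi> k \<tau> * \<phi> k \<rho>) + 6 * (\<phi> k \<rho> * \<phi> k \<pi>))\<bar> \<le> B * 16"
    unfolding abs_mult[of "f \<sigma> \<tau>"] using f[OF C(1,2)] by (intro mult_mono) auto
qed

text \<open>
  The random couplings are \<open>a\<^sub>k(t) \<xi>\<^sub>k\<close> with independent standard Gaussian \<open>\<xi>\<^sub>k\<close>. Differentiating in \<open>t\<close>
  produces \<open>a\<^sub>k' \<xi>\<^sub>k\<close> times a first partial derivative, and integration by parts in \<open>\<xi>\<^sub>k\<close> trades the factor
  \<open>\<xi>\<^sub>k\<close> for \<open>a\<^sub>k\<close> times the second partial derivative. Gibbs averages of bounded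
  functions are bounded, which justifies both steps.
\<close>
lemma DERIV_gaussian_interpolation:
  fixes a a' :: "'k \<Rightarrow> real \<Rightarrow> real" and f f' :: "real \<Rightarrow> 'c \<Rightarrow> 'c \<Rightarrow> real"
  assumes da: "\<And>k t. k \<in> K \<Longrightarrow> (a k has_real_derivative a' k t) (at t)"
    and df: "\<And>\<sigma> \<tau> t. ((\<lambda>t. f t \<sigma> \<tau>) has_real_derivative f' t \<sigma> \<tau>) (at t)"
    and ba': "\<And>k t. k \<in> K \<Longrightarrow> \<bar>a' k t\<bar> \<le> A k"
    and bf: "\<And>\<sigma> \<tau> t. \<sigma> \<in> C \<Longrightarrow> \<tau> \<in> C \<Longrightarrow> \<bar>f t \<sigma> \<tau>\<bar> \<le> B"
    and bf': "\<And>\<sigma> \<tau> t. \<sigma> \<in> C \<Longrightarrow> \<tau> \<in> C \<Longrightarrow> \<bar>f' t \<sigma> \<tau>\<bar> \<le> B'"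
  shows "((\<lambda>t. \<integral>\<xi>. avg2 (\<lambda>k. a k t * \<xi> k) (f t) \<partial>gaussian_family K) has_real_derivative
     (\<integral>\<xi>. avg2 (\<lambda>k. a k t * \<xi> k) (f' t)
        + (\<Sum>k\<in>K. a k t * a' k t * hess k (f t) (\<lambda>k. a k t * \<xi> k)) \<partial>gaussian_family K)) (at t)"
proof -
  let ?P = "gaussian_family K"
  interpret PK: prob_space ?P by (rule prob_space_gaussian_family)
  define X where "X t \<xi> = (\<lambda>k. a k t * \<xi> k)" for t and \<xi> :: "'k \<Rightarrow> real"
  have mX: "(\<lambda>\<xi>. X t \<xi> k) \<in> borel_measurable ?P" if "k \<in> K" for k t
    unfolding X_def using borel_measurable_gaussian_component[OF that] by measurable
  have mG: "(\<lambda>\<xi>. avg2 (X t \<xi>) (f t)) \<in> borel_measurable ?P"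
    "(\<lambda>\<xi>. avg2 (X t \<xi>) (f' t)) \<in> borel_measurable ?P" for t
    by (intro borel_measurable_avg mX; simp)+
  have mgrad: "(\<lambda>\<xi>. grad k (f t) (X t \<xi>)) \<in> borel_measurable ?P" if "k \<in> K" for k t
    unfolding grad_def
    by (intro borel_measurable_avg mX borel_measurable_times borel_measurable_diff
        borel_measurable_const) simp_all
  have mhess: "(\<lambda>\<xi>. hess k (f t) (X t \<xi>)) \<in> borel_measurable ?P" if "k \<in> K" for k t
    unfolding hess_def by (intro borel_measurable_avg mX borel_measurable_const) simp_all
  define G' where "G' t \<xi> = avg2 (X t \<xi>) (f' t) + (\<Sum>k\<in>K. a' k t * (\<xi> k * grad k (f t) (X t \<xi>)))" for t \<xi>
  have "((\<lambda>t. \<integral>\<xi>. avg2 (X t \<xi>) (f t) \<partial>?P) has_real_derivative (\<integral>\<xi>. G' t \<xi> \<partial>?P)) (at t)"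
  proof (rule DERIV_integral)
    show "((\<lambda>t. avg2 (X t \<xi>) (f t)) has_real_derivative G' t \<xi>) (at t)" for t \<xi>
    proof -
      have "((\<lambda>t. X t \<xi> k) has_real_derivative a' k t * \<xi> k) (at t)" if "k \<in> K" for k
        unfolding X_def using da[OF that] by (rule DERIV_cmult_right)
      from DERIV_avg2[OF this df]
      have "((\<lambda>t. avg2 (X t \<xi>) (f t)) has_real_derivative
         avg2 (X t \<xi>) (\<lambda>\<sigma> \<tau>. f' t \<sigma> \<tau> + f t \<sigma> \<tau> *
           (\<Sum>k\<in>K. a' k t * \<xi> k * (\<phi> k \<sigma> + \<phi> k \<tau> - 2 * avg (X t \<xi>) (\<phi> k))))) (at t)" .
      also have "avg2 (X t \<xi>) (\<lambda>\<sigma> \<tau>. f' t \<sigma> \<tau> + f t \<sigma> \<tau> *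
           (\<Sum>k\<in>K. a' k t * \<xi> k * (\<phi> k \<sigma> + \<phi> k \<tau> - 2 * avg (X t \<xi>) (\<phi> k)))) = G' t \<xi>"
      proof -
        have "avg2 (X t \<xi>) (\<lambda>\<sigma> \<tau>. f t \<sigma> \<tau> *
           (\<Sum>k\<in>K. a' k t * \<xi> k * (\<phi> k \<sigma> + \<phi> k \<tau> - 2 * avg (X t \<xi>) (\<phi> k))))
         = avg2 (X t \<xi>) (\<lambda>\<sigma> \<tau>. \<Sum>k\<in>K. (a' k t * \<xi> k) * (f t \<sigma> \<tau> * (\<phi> k \<sigma> + \<phi> k \<tau> - 2 * avg (X t \<xi>) (\<phi> k))))"
          by (simp only: sum_distrib_left mult.left_commute)
        also have "\<dots> = (\<Sum>k\<in>K. a' k t * (\<xi> k * grad k (f t) (X t \<xi>)))"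
          by (simp only: avg_sum avg_cmult grad_def mult.assoc)
        finally show ?thesis unfolding G'_def avg_add by simp
      qed
      finally show ?thesis .
    qed
    show "integrable ?P (\<lambda>\<xi>. avg2 (X t \<xi>) (f t))" for t
      using mG(1) by (intro PK.integrable_const_bound[of _ B]) (auto intro!: AE_I2 avg_abs_le bf)
    show "G' t \<in> borel_measurable ?P" for t
      unfolding G'_def using mG(2) mgrad borel_measurable_gaussian_component
      by (intro borel_measurable_add borel_measurable_sum borel_measurable_times) auto
    show "integrable ?P (\<lambda>\<xi>. B' + (\<Sum>k\<in>K. A k * (\<bar>\<xi> k\<bar> * (B * 4))))"
      by (intro Bochner_Integration.integrable_add Bochner_Integration.integrable_sum
          integrable_mult_right integrable_mult_left integrable_gaussian_component) auto
    show "\<bar>G' t \<xi>\<bar> \<le> B' + (\<Sum>k\<in>K. A k * (\<bar>\<xi> k\<bar> * (B * 4)))" for t \<xi>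
    proof -
      have "\<bar>a' k t * (\<xi> k * grad k (f t) (X t \<xi>))\<bar> \<le> A k * (\<bar>\<xi> k\<bar> * (B * 4))" if "k \<in> K" for k
      proof -
        have "\<bar>grad k (f t) (X t \<xi>)\<bar> \<le> B * 4" by (rule abs_grad_le[OF that]) (rule bf)
        then show ?thesis
          unfolding abs_mult using ba'[OF that, of t] by (intro mult_mono) auto
      qed
      then have "\<bar>\<Sum>k\<in>K. a' k t * (\<xi> k * grad k (f t) (X t \<xi>))\<bar> \<le> (\<Sum>k\<in>K. A k * (\<bar>\<xi> k\<bar> * (B * 4)))"
        by (intro order.trans[OF sum_abs] sum_mono)
      moreover have "\<bar>avg2 (X t \<xi>) (f' t)\<bar> \<le> B'" by (intro avg_abs_le bf')
      ultimately show ?thesis unfolding G'_def by linarith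
    qed
  qed
  also have "(\<integral>\<xi>. G' t \<xi> \<partial>?P)
      = (\<integral>\<xi>. avg2 (X t \<xi>) (f' t) + (\<Sum>k\<in>K. a k t * a' k t * hess k (f t) (X t \<xi>)) \<partial>?P)"
  proof -
    have parts: "integrable ?P (\<lambda>\<xi>. \<xi> k * grad k (f t) (X t \<xi>))"
      "(\<integral>\<xi>. \<xi> k * grad k (f t) (X t \<xi>) \<partial>?P) = (\<integral>\<xi>. a k t * hess k (f t) (X t \<xi>) \<partial>?P)" if "k \<in> K" for k
    proof -
      have [measurable]: "(\<lambda>\<xi>. a k t * hess k (f t) (X t \<xi>)) \<in> borel_measurable ?P"
        using mhess[OF that] by measurable
      have c: "continuous_on UNIV (\<lambda>y. a k t * hess k (f t) (X t (x(k := y))))" for x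
      proof (intro continuous_intros continuous_on_hess that)
        show "continuous_on UNIV (\<lambda>y. X t (x(k := y)) l)" for l
          unfolding X_def by (cases "l = k") (auto intro!: continuous_intros)
      qed
      have b: "\<bar>a k t * hess k (f t) (X t \<xi>)\<bar> \<le> \<bar>a k t\<bar> * (B * 16)" for \<xi>
        unfolding abs_mult using abs_hess_le[OF that bf] by (intro mult_left_mono) auto
      have d: "((\<lambda>y. grad k (f t) (X t (x(k := y)))) has_real_derivative a k t * hess k (f t) (X t (x(k := y)))) (at y)" for x y
        unfolding X_def by (rule DERIV_grad_coordinate[OF that])
      show "integrable ?P (\<lambda>\<xi>. \<xi> k * grad k (f t) (X t \<xi>))"
        "(\<integral>\<xi>. \<xi> k * grad k (f t) (X t \<xi>) \<partial>?P) = (\<integral>\<xi>. a k t * hess k (f t) (X t \<xi>) \<partial>?P)"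
        by (rule gaussian_family_integration_by_parts[OF finK that mgrad[OF that] _ d c abs_grad_le[OF that bf] b]; simp)+
    qed
    have ih: "integrable ?P (\<lambda>\<xi>. hess k (f t) (X t \<xi>))" if "k \<in> K" for k
      using mhess[OF that]
      by (intro PK.integrable_const_bound[of _ "B * 16"]) (auto intro!: AE_I2 abs_hess_le that bf)
    have i0: "integrable ?P (\<lambda>\<xi>. avg2 (X t \<xi>) (f' t))"
      using mG(2) by (intro PK.integrable_const_bound[of _ B']) (auto intro!: AE_I2 avg_abs_le bf')
    have assoc: "a k t * a' k t * hess k (f t) (X t \<xi>) = a' k t * (a k t * hess k (f t) (X t \<xi>))" for k \<xi>
      by simp
    show ?thesis
      unfolding G'_def assoc using i0 parts ih by simp
  qed
  finally show ?thesis unfolding X_def .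
qed

end

section \<open>Comparison along a path of couplings\<close>

context finite_gibbs
begin

lemma sum_hess:
  fixes b :: "'k \<Rightarrow> real"
  defines "\<kappa> \<equiv> \<lambda>\<sigma> \<tau>. \<Sum>k\<in>K. b k * (\<phi> k \<sigma> * \<phi> k \<tau>)"
  shows "(\<Sum>k\<in>K. b k * hess k f x) = avg2 x (\<lambda>\<sigma> \<tau>. avg2 x (\<lambda>\<rho> \<pi>. f \<sigma> \<tau> *
     (2 * \<kappa> \<sigma> \<tau> - 4 * \<kappa> \<sigma> \<rho> - 4 * \<kappa> \<tau> \<rho> + 6 * \<kappa> \<rho> \<pi>)))"
proof -
  have "(\<Sum>k\<in>K. b k * hess k f x) = avg2 x (\<lambda>\<sigma> \<tau>. avg2 x (\<lambda>\<rho> \<pi>. \<Sum>k\<in>K. b k * (f \<sigma> \<tau> *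
     (2 * (\<phi> k \<sigma> * \<phi> k \<tau>) - 4 * (\<phi> k \<sigma> * \<phi> k \<rho>) - 4 * (\<phi> k \<tau> * \<phi> k \<rho>) + 6 * (\<phi> k \<rho> * \<phi> k \<pi>)))))"
    by (simp only: hess_def avg_sum avg_cmult)
  also have "\<dots> = avg2 x (\<lambda>\<sigma> \<tau>. avg2 x (\<lambda>\<rho> \<pi>. f \<sigma> \<tau> *
     (2 * \<kappa> \<sigma> \<tau> - 4 * \<kappa> \<sigma> \<rho> - 4 * \<kappa> \<tau> \<rho> + 6 * \<kappa> \<rho> \<pi>)))"
    by (intro avg_cong)
      (simp add: \<kappa>_def sum_distrib_left algebra_simps flip: sum.distrib sum_subtractf)
  finally show ?thesis .
qed

text \<open>
  \<open>V\<close> and \<open>exp (c V)\<close> are nondecreasing functions of the same variable, hence positively correlated: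
  \<open>(V - v) (exp (c V) - exp (c v))\<close> is nonnegative, in particular when \<open>v\<close> is the mean of \<open>V\<close>.
\<close>
lemma chebyshev_pair:
  assumes "c \<ge> 0"
  shows "avg2 x V * avg2 x (\<lambda>\<sigma> \<tau>. exp (c * V \<sigma> \<tau>)) \<le> avg2 x (\<lambda>\<sigma> \<tau>. V \<sigma> \<tau> * exp (c * V \<sigma> \<tau>))"
proof -
  define v where "v = avg2 x V"
  have "0 \<le> (V \<sigma> \<tau> - v) * (exp (c * V \<sigma> \<tau>) - exp (c * v))" for \<sigma> \<tau>
  proof (cases "v \<le> V \<sigma> \<tau>")
    case True
    then have "c * v \<le> c * V \<sigma> \<tau>" using assms by (rule mult_left_mono)
    then show ?thesis using True by (intro mult_nonneg_nonneg) auto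
  next
    case False
    then have "c * V \<sigma> \<tau> \<le> c * v" using assms by (intro mult_left_mono) auto
    then show ?thesis using False by (intro mult_nonpos_nonpos) auto
  qed
  then have "0 \<le> avg2 x (\<lambda>\<sigma> \<tau>. (V \<sigma> \<tau> - v) * (exp (c * V \<sigma> \<tau>) - exp (c * v)))"
    using avg_mono[of "\<lambda>_. 0" _ x] by (simp add: avg_const avg_mono)
  also have "\<dots> = avg2 x (\<lambda>\<sigma> \<tau>. V \<sigma> \<tau> * exp (c * V \<sigma> \<tau>)) - v * avg2 x (\<lambda>\<sigma> \<tau>. exp (c * V \<sigma> \<tau>))"
    by (simp add: left_diff_distrib right_diff_distrib avg_linear v_def)
  finally show ?thesis by (simp add: v_def)
qed

lemma chebyshev_single:
  assumes "c \<ge> 0"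
  shows "avg x V * avg x (\<lambda>\<sigma>. exp (c * V \<sigma>)) \<le> avg x (\<lambda>\<sigma>. V \<sigma> * exp (c * V \<sigma>))"
  using chebyshev_pair[OF assms, of x "\<lambda>_. V"] by (simp add: avg_const)

text \<open>
  The kernel \<open>s Q + r\<close> is the rate at which the covariance of the energy changes. Its constant part \<open>r\<close>
  disappears because the coefficients \<open>2 - 4 - 4 + 6\<close> of the second derivative sum to zero. In the
  rest, \<open>Q\<close> is bounded by \<open>V\<close> where it has a positive coefficient, and \<open>- Q\<close> by \<open>(\<alpha> - 1) V\<close> where it has
  a negative one, which leaves the total weight \<open>2 + 4 (\<alpha> - 1) + 4 (\<alpha> - 1) + 6 = 8 \<alpha>\<close>.
  The correlation inequality moves every \<open>V\<close> onto the pair of replicas on which \<open>exp (c V)\<close> lives.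
\<close>
lemma sum_hess_le:
  fixes b :: "'k \<Rightarrow> real"
  assumes c: "c \<ge> 0" and s: "s \<ge> 0" and \<alpha>: "\<alpha> \<ge> 1"
    and \<kappa>: "\<And>\<sigma> \<tau>. \<sigma> \<in> C \<Longrightarrow> \<tau> \<in> C \<Longrightarrow>
       (\<Sum>k\<in>K. b k * (\<phi> k \<sigma> * \<phi> k \<tau>)) = s * Q \<sigma> \<tau> + r"
    and sym: "\<And>\<sigma> \<tau>. V \<sigma> \<tau> = V \<tau> \<sigma>"
    and QV: "\<And>\<sigma> \<tau>. Q \<sigma> \<tau> \<le> V \<sigma> \<tau>" "\<And>\<sigma> \<tau>. - Q \<sigma> \<tau> \<le> (\<alpha> - 1) * V \<sigma> \<tau>"
  shows "(\<Sum>k\<in>K. b k * hess k (\<lambda>\<sigma> \<tau>. exp (c * V \<sigma> \<tau>)) x)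
     \<le> 8 * \<alpha> * s * avg2 x (\<lambda>\<sigma> \<tau>. V \<sigma> \<tau> * exp (c * V \<sigma> \<tau>))"
proof -
  let ?f = "\<lambda>\<sigma> \<tau>. exp (c * V \<sigma> \<tau>)"
  let ?T = "avg2 x (\<lambda>\<sigma> \<tau>. V \<sigma> \<tau> * ?f \<sigma> \<tau>)"
  have T3: "avg2 x (\<lambda>\<sigma> \<tau>. ?f \<sigma> \<tau> * avg x (V \<sigma>)) \<le> ?T"
    using chebyshev_single[OF c, of x] by - (rule avg_mono, simp add: avg_cmult_right mult.commute)
  have T3': "avg2 x (\<lambda>\<sigma> \<tau>. ?f \<sigma> \<tau> * avg x (V \<tau>)) \<le> ?T"
  proof -
    have "avg2 x (\<lambda>\<sigma> \<tau>. ?f \<sigma> \<tau> * avg x (V \<tau>)) = avg2 x (\<lambda>\<tau> \<sigma>. ?f \<tau> \<sigma> * avg x (V \<tau>))"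
      by (subst avg_swap) (simp add: sym)
    then show ?thesis using T3 by simp
  qed
  have "(\<Sum>k\<in>K. b k * hess k ?f x) = avg2 x (\<lambda>\<sigma> \<tau>. avg2 x (\<lambda>\<rho> \<pi>. ?f \<sigma> \<tau> *
     (s * (2 * Q \<sigma> \<tau> - 4 * Q \<sigma> \<rho> - 4 * Q \<tau> \<rho> + 6 * Q \<rho> \<pi>))))"
    unfolding sum_hess by (intro avg_cong) (simp add: \<kappa> algebra_simps)
  also have "\<dots> \<le> avg2 x (\<lambda>\<sigma> \<tau>. avg2 x (\<lambda>\<rho> \<pi>. ?f \<sigma> \<tau> *
     (s * (2 * V \<sigma> \<tau> + 4 * ((\<alpha> - 1) * V \<sigma> \<rho>) + 4 * ((\<alpha> - 1) * V \<tau> \<rho>) + 6 * V \<rho> \<pi>))))"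
  proof (intro avg_mono mult_left_mono)
    fix \<sigma> \<tau> \<rho> \<pi>
    show "2 * Q \<sigma> \<tau> - 4 * Q \<sigma> \<rho> - 4 * Q \<tau> \<rho> + 6 * Q \<rho> \<pi>
       \<le> 2 * V \<sigma> \<tau> + 4 * ((\<alpha> - 1) * V \<sigma> \<rho>) + 4 * ((\<alpha> - 1) * V \<tau> \<rho>) + 6 * V \<rho> \<pi>"
      using QV(1)[of \<sigma> \<tau>] QV(2)[of \<sigma> \<rho>] QV(2)[of \<tau> \<rho>] QV(1)[of \<rho> \<pi>] by linarith
  qed (use s in auto)
  also have "\<dots> = s * (2 * ?T + 4 * (\<alpha> - 1) * avg2 x (\<lambda>\<sigma> \<tau>. ?f \<sigma> \<tau> * avg x (V \<sigma>))
      + 4 * (\<alpha> - 1) * avg2 x (\<lambda>\<sigma> \<tau>. ?f \<sigma> \<tau> * avg x (V \<tau>)) + 6 * (avg2 x V * avg2 x ?f))"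
    by (simp add: avg_linear algebra_simps)
  also have "\<dots> \<le> s * (2 * ?T + 4 * (\<alpha> - 1) * ?T + 4 * (\<alpha> - 1) * ?T + 6 * ?T)"
    using s \<alpha> T3 T3' chebyshev_pair[OF c, of x V]
    by (intro mult_left_mono add_mono) auto
  also have "\<dots> = 8 * \<alpha> * s * ?T" by (simp add: algebra_simps)
  finally show ?thesis .
qed

text \<open>
  The path of couplings is \<open>(u\<^sub>k sin t + v\<^sub>k cos t) \<xi>\<^sub>k\<close>; the trigonometric parametrization keeps it smooth at
  both ends, where weights \<open>sqrt t\<close> and \<open>sqrt (1 - t)\<close> would not be. By the previous bound the average of
  \<open>exp (c V)\<close> grows at rate at most \<open>8 \<alpha> s sin t cos t\<close> times the average of \<open>V exp (c V)\<close>. Lowering the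
  exponent as \<open>c(t) = \<eta> + 4 \<alpha> s cos\<^sup>2 t\<close> contributes exactly the opposite of this, so the interpolated
  average does not increase from \<open>t = 0\<close> to \<open>t = pi / 2\<close>.
\<close>
theorem gaussian_comparison:
  fixes u v :: "'k \<Rightarrow> real"
  assumes \<eta>: "\<eta> \<ge> 0" and s: "s \<ge> 0" and \<alpha>: "\<alpha> \<ge> 1"
    and uv: "\<And>k. k \<in> K \<Longrightarrow> u k * v k = 0"
    and \<kappa>: "\<And>\<sigma> \<tau>. \<sigma> \<in> C \<Longrightarrow> \<tau> \<in> C \<Longrightarrow>
       (\<Sum>k\<in>K. ((u k)\<^sup>2 - (v k)\<^sup>2) * (\<phi> k \<sigma> * \<phi> k \<tau>)) = s * Q \<sigma> \<tau> + r"
    and sym: "\<And>\<sigma> \<tau>. V \<sigma> \<tau> = V \<tau> \<sigma>"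
    and QV: "\<And>\<sigma> \<tau>. Q \<sigma> \<tau> \<le> V \<sigma> \<tau>" "\<And>\<sigma> \<tau>. - Q \<sigma> \<tau> \<le> (\<alpha> - 1) * V \<sigma> \<tau>"
  shows "(\<integral>\<xi>. avg2 (\<lambda>k. u k * \<xi> k) (\<lambda>\<sigma> \<tau>. exp (\<eta> * V \<sigma> \<tau>)) \<partial>gaussian_family K)
     \<le> (\<integral>\<xi>. avg2 (\<lambda>k. v k * \<xi> k) (\<lambda>\<sigma> \<tau>. exp ((\<eta> + 4 * \<alpha> * s) * V \<sigma> \<tau>)) \<partial>gaussian_family K)"
proof -
  define a where "a k t = u k * sin t + v k * cos t" for k and t :: real
  define a' where "a' k t = u k * cos t - v k * sin t" for k and t :: real
  define c where "c t = \<eta> + 4 * \<alpha> * s * (cos t)\<^sup>2" for t :: real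
  define c' where "c' t = - (8 * \<alpha> * s * (sin t * cos t))" for t :: real
  define f where "f t \<sigma> \<tau> = exp (c t * V \<sigma> \<tau>)" for t \<sigma> \<tau>
  define f' where "f' t \<sigma> \<tau> = c' t * (V \<sigma> \<tau> * f t \<sigma> \<tau>)" for t \<sigma> \<tau>
  have V0: "V \<sigma> \<tau> \<ge> 0" for \<sigma> \<tau>
  proof -
    have "0 \<le> \<alpha> * V \<sigma> \<tau>" using QV[of \<sigma> \<tau>] by (simp add: algebra_simps)
    then show ?thesis using \<alpha> by (simp add: zero_le_mult_iff)
  qed
  define m where "m = (\<Sum>\<sigma>\<in>C. \<Sum>\<tau>\<in>C. V \<sigma> \<tau>)"
  have Vm: "V \<sigma> \<tau> \<le> m" if "\<sigma> \<in> C" "\<tau> \<in> C" for \<sigma> \<tau>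
  proof -
    have "V \<sigma> \<tau> \<le> (\<Sum>\<tau>\<in>C. V \<sigma> \<tau>)" using that V0 finC by (intro member_le_sum) auto
    also have "\<dots> \<le> m" unfolding m_def
      using that V0 finC by (intro member_le_sum sum_nonneg) auto
    finally show ?thesis .
  qed
  have \<alpha>s: "\<alpha> * s \<ge> 0" using \<alpha> s by simp
  have cos2: "(cos t)\<^sup>2 \<le> 1" for t :: real by (simp add: abs_square_le_1)
  have c0: "c t \<ge> 0" for t using \<eta> \<alpha>s by (simp add: c_def)
  have c1: "c t \<le> \<eta> + 4 * \<alpha> * s" for t
    using mult_left_mono[OF cos2 \<alpha>s, of t] by (simp add: c_def)
  have f_bound: "\<bar>f t \<sigma> \<tau>\<bar> \<le> exp ((\<eta> + 4 * \<alpha> * s) * m)" if "\<sigma> \<in> C" "\<tau> \<in> C" for t \<sigma> \<tau>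
    unfolding f_def abs_exp_cancel exp_le_cancel_iff
    using c0 c1 V0 Vm[OF that] order.trans[OF c0 c1] by (intro mult_mono) auto
  have c'_bound: "\<bar>c' t\<bar> \<le> 8 * \<alpha> * s" for t
  proof -
    have "\<bar>sin t * cos t\<bar> \<le> 1 * 1" unfolding abs_mult by (intro mult_mono) auto
    then show ?thesis
      using mult_left_mono[of "\<bar>sin t * cos t\<bar>" 1 "8 * (\<alpha> * s)"] \<alpha>s \<alpha> s by (simp add: c'_def abs_mult)
  qed
  have f'_bound: "\<bar>f' t \<sigma> \<tau>\<bar> \<le> 8 * \<alpha> * s * (m * exp ((\<eta> + 4 * \<alpha> * s) * m))"
    if "\<sigma> \<in> C" "\<tau> \<in> C" for t \<sigma> \<tau>
    unfolding f'_def abs_mult using c'_bound V0 Vm[OF that] f_bound[OF that] \<alpha> s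
    by (intro mult_mono) (auto intro: order.trans[OF V0])
  define \<psi> where "\<psi> t = (\<integral>\<xi>. avg2 (\<lambda>k. a k t * \<xi> k) (f t) \<partial>gaussian_family K)" for t
  have D: "(\<psi> has_real_derivative
     (\<integral>\<xi>. avg2 (\<lambda>k. a k t * \<xi> k) (f' t)
        + (\<Sum>k\<in>K. a k t * a' k t * hess k (f t) (\<lambda>k. a k t * \<xi> k)) \<partial>gaussian_family K)) (at t)" for t
    unfolding \<psi>_def
  proof (rule DERIV_gaussian_interpolation[where A = "\<lambda>k. \<bar>u k\<bar> + \<bar>v k\<bar>"])
    show "(a k has_real_derivative a' k t) (at t)" for k t
      unfolding a_def[abs_def] a'_def by (auto intro!: derivative_eq_intros)
    show "((\<lambda>t. f t \<sigma> \<tau>) has_real_derivative f' t \<sigma> \<tau>) (at t)" for \<sigma> \<tau> t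
      unfolding f_def f'_def c_def c'_def by (auto intro!: derivative_eq_intros simp: algebra_simps)
    show "\<bar>a' k t\<bar> \<le> \<bar>u k\<bar> + \<bar>v k\<bar>" for k t
    proof -
      have "\<bar>u k * cos t\<bar> \<le> \<bar>u k\<bar> * 1" "\<bar>v k * sin t\<bar> \<le> \<bar>v k\<bar> * 1"
        unfolding abs_mult by (intro mult_left_mono; simp)+
      then show ?thesis unfolding a'_def by linarith
    qed
  qed (use f_bound f'_bound in auto)
  have le0: "avg2 (\<lambda>k. a k t * \<xi> k) (f' t)
        + (\<Sum>k\<in>K. a k t * a' k t * hess k (f t) (\<lambda>k. a k t * \<xi> k)) \<le> 0"
    if t: "0 \<le> t" "t \<le> pi / 2" for t \<xi>
  proof -
    have sc: "0 \<le> sin t * cos t"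
      using t by (intro mult_nonneg_nonneg sin_ge_zero cos_ge_zero) auto
    have "(\<Sum>k\<in>K. a k t * a' k t * (\<phi> k \<sigma> * \<phi> k \<tau>)) = (sin t * cos t * s) * Q \<sigma> \<tau> + sin t * cos t * r"
      if "\<sigma> \<in> C" "\<tau> \<in> C" for \<sigma> \<tau>
    proof -
      have "a k t * a' k t = sin t * cos t * ((u k)\<^sup>2 - (v k)\<^sup>2)" if "k \<in> K" for k
      proof -
        have "a k t * a' k t = sin t * cos t * ((u k)\<^sup>2 - (v k)\<^sup>2) + (u k * v k) * ((cos t)\<^sup>2 - (sin t)\<^sup>2)"
          by (simp add: a_def a'_def algebra_simps power2_eq_square)
        then show ?thesis using uv[OF that] by simp
      qed
      then have "(\<Sum>k\<in>K. a k t * a' k t * (\<phi> k \<sigma> * \<phi> k \<tau>))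
         = sin t * cos t * (\<Sum>k\<in>K. ((u k)\<^sup>2 - (v k)\<^sup>2) * (\<phi> k \<sigma> * \<phi> k \<tau>))"
        by (simp add: sum_distrib_left mult.assoc)
      then show ?thesis using \<kappa>[OF that] by (simp add: algebra_simps)
    qed
    from sum_hess_le[OF c0 _ \<alpha> this sym QV, of t "\<lambda>k. a k t * \<xi> k"]
    have "(\<Sum>k\<in>K. a k t * a' k t * hess k (f t) (\<lambda>k. a k t * \<xi> k))
       \<le> 8 * \<alpha> * (sin t * cos t * s) * avg2 (\<lambda>k. a k t * \<xi> k) (\<lambda>\<sigma> \<tau>. V \<sigma> \<tau> * f t \<sigma> \<tau>)"
      using sc s unfolding f_def by auto
    moreover have "avg2 (\<lambda>k. a k t * \<xi> k) (f' t)
       = c' t * avg2 (\<lambda>k. a k t * \<xi> k) (\<lambda>\<sigma> \<tau>. V \<sigma> \<tau> * f t \<sigma> \<tau>)"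
      unfolding f'_def[abs_def] by (simp only: avg_cmult)
    ultimately show ?thesis by (simp add: c'_def algebra_simps)
  qed
  have "\<psi> (pi / 2) \<le> \<psi> 0"
  proof (rule DERIV_nonpos_imp_nonincreasing[of 0 "pi / 2" \<psi>])
    fix t :: real assume "0 \<le> t" "t \<le> pi / 2"
    note le0[OF this]
    then have "0 \<le> (\<integral>\<xi>. - (avg2 (\<lambda>k. a k t * \<xi> k) (f' t)
        + (\<Sum>k\<in>K. a k t * a' k t * hess k (f t) (\<lambda>k. a k t * \<xi> k))) \<partial>gaussian_family K)"
      by (intro Bochner_Integration.integral_nonneg) (simp only: neg_0_le_iff_le)
    then show "\<exists>y. (\<psi> has_real_derivative y) (at t) \<and> y \<le> 0"
      using D[of t] unfolding Bochner_Integration.integral_minus by (intro exI conjI) auto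
  qed simp
  then show ?thesis by (simp add: \<psi>_def a_def f_def[abs_def] c_def)
qed

end

section \<open>Independent spins in a random field\<close>

text \<open>
  One family of Gaussians serves both ends of the interpolation: the index \<open>(i, j)\<close> with \<open>i < j\<close> is for
  the interaction of two sites and \<open>(i, i)\<close> for the random field at the site \<open>i\<close>.
\<close>
definition spin_couplings :: "nat \<Rightarrow> (nat \<times> nat) set" where
  "spin_couplings N = {(i, j). 1 \<le> i \<and> i \<le> j \<and> j \<le> N}"

definition spin_monomial :: "nat \<times> nat \<Rightarrow> (nat \<Rightarrow> real) \<Rightarrow> real" where
  "spin_monomial k \<sigma> = (if fst k = snd k then \<sigma> (fst k) else \<sigma> (fst k) * \<sigma> (snd k))"

definition field_weight :: "nat \<Rightarrow> real \<Rightarrow> (nat \<Rightarrow> real) \<Rightarrow> real" where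
  "field_weight N h \<sigma> = exp (h * (\<Sum>i=1..N. \<sigma> i))"

lemma finite_spin_couplings: "finite (spin_couplings N)"
  by (rule finite_subset[of _ "{1..N} \<times> {1..N}"]) (auto simp: spin_couplings_def)

lemma finite_configs: "finite (configs N)"
  by (simp add: configs_def finite_PiE)

lemma configs_sq: "\<sigma> \<in> configs N \<Longrightarrow> i \<in> {1..N} \<Longrightarrow> \<sigma> i * \<sigma> i = 1"
  unfolding configs_def by (drule PiE_mem, assumption) auto

lemma finite_gibbs_spin:
  "finite_gibbs (spin_couplings N) (configs N) (field_weight N h) spin_monomial"
proof
  show "configs N \<noteq> {}" by (simp add: configs_def PiE_eq_empty_iff)
  fix k \<sigma> assume "k \<in> spin_couplings N" and s: "\<sigma> \<in> configs N"
  then have "fst k \<in> {1..N}" "snd k \<in> {1..N}" by (auto simp: spin_couplings_def)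
  with configs_sq[OF s] have "\<sigma> (fst k) * \<sigma> (fst k) = 1" "\<sigma> (snd k) * \<sigma> (snd k) = 1" by blast+
  then show "spin_monomial k \<sigma> * spin_monomial k \<sigma> = 1"
    by (simp add: spin_monomial_def algebra_simps)
qed (simp_all add: finite_spin_couplings finite_configs field_weight_def)

lemma sum_configs_prod:
  "(\<Sum>\<sigma>\<in>configs N. \<Prod>i=1..N. g i (\<sigma> i)) = (\<Prod>i=1..N. g i 1 + g i (-1 :: real) :: real)"
proof -
  have "(\<Sum>\<sigma>\<in>configs N. \<Prod>i=1..N. g i (\<sigma> i)) = (\<Prod>i=1..N. \<Sum>s\<in>{-1, 1}. g i s)"
    unfolding configs_def by (rule prod_sum_PiE[symmetric]) auto
  then show ?thesis by (simp add: add.commute)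
qed

abbreviation spin_weight :: "nat \<Rightarrow> real \<Rightarrow> (nat \<times> nat \<Rightarrow> real) \<Rightarrow> (nat \<Rightarrow> real) \<Rightarrow> real" where
  "spin_weight N h \<equiv> finite_gibbs.weight (spin_couplings N) (field_weight N h) spin_monomial"

abbreviation spin_Z :: "nat \<Rightarrow> real \<Rightarrow> (nat \<times> nat \<Rightarrow> real) \<Rightarrow> real" where
  "spin_Z N h \<equiv> finite_gibbs.Z (spin_couplings N) (configs N) (field_weight N h) spin_monomial"

abbreviation spin_avg :: "nat \<Rightarrow> real \<Rightarrow> (nat \<times> nat \<Rightarrow> real) \<Rightarrow> ((nat \<Rightarrow> real) \<Rightarrow> real) \<Rightarrow> real" where
  "spin_avg N h \<equiv> finite_gibbs.avg (spin_couplings N) (configs N) (field_weight N h) spin_monomial"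

abbreviation spin_avg2 :: "nat \<Rightarrow> real \<Rightarrow> (nat \<times> nat \<Rightarrow> real) \<Rightarrow>
    ((nat \<Rightarrow> real) \<Rightarrow> (nat \<Rightarrow> real) \<Rightarrow> real) \<Rightarrow> real" where
  "spin_avg2 N h x f \<equiv> spin_avg N h x (\<lambda>\<sigma>. spin_avg N h x (f \<sigma>))"

lemmas spin_weight_def = finite_gibbs.weight_def[OF finite_gibbs_spin]
lemmas spin_Z_def = finite_gibbs.Z_def[OF finite_gibbs_spin]
lemmas spin_avg_def = finite_gibbs.avg_def[OF finite_gibbs_spin]
lemmas spin_avg_cmult = finite_gibbs.avg_cmult[OF finite_gibbs_spin]

lemma weight_external:
  fixes x :: "nat \<times> nat \<Rightarrow> real"
  assumes x_off: "\<And>i j. i < j \<Longrightarrow> x (i, j) = 0" and u: "\<And>i. u i = x (i, i) + h"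
  shows "spin_weight N h x \<sigma> = (\<Prod>i=1..N. exp (u i * \<sigma> i))"
proof -
  have "(\<Sum>k\<in>spin_couplings N. x k * spin_monomial k \<sigma>) = (\<Sum>k\<in>(\<lambda>i. (i, i)) ` {1..N}. x k * spin_monomial k \<sigma>)"
  proof (rule sum.mono_neutral_right[OF finite_spin_couplings])
    show "(\<lambda>i. (i, i)) ` {1..N} \<subseteq> spin_couplings N" by (auto simp: spin_couplings_def)
    show "\<forall>k\<in>spin_couplings N - (\<lambda>i. (i, i)) ` {1..N}. x k * spin_monomial k \<sigma> = 0"
    proof
      fix k assume k: "k \<in> spin_couplings N - (\<lambda>i. (i, i)) ` {1..N}"
      obtain i j where ij: "k = (i, j)" by (cases k)
      with k have "i < j" by (cases "i = j") (auto simp: spin_couplings_def)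
      then show "x k * spin_monomial k \<sigma> = 0" using x_off ij by simp
    qed
  qed
  also have "\<dots> = (\<Sum>i=1..N. x (i, i) * \<sigma> i)"
    by (subst sum.reindex) (auto simp: inj_on_def spin_monomial_def)
  finally show ?thesis
    by (simp add: spin_weight_def field_weight_def u distrib_right sum.distrib sum_distrib_left
        flip: exp_sum exp_add)
qed

text \<open>
  Without interactions the Gibbs measure is a product of two-point measures.
\<close>
lemma avg_external_prod:
  fixes x :: "nat \<times> nat \<Rightarrow> real"
  assumes x_off: "\<And>i j. i < j \<Longrightarrow> x (i, j) = 0" and u: "\<And>i. u i = x (i, i) + h"
  shows "spin_avg N h x (\<lambda>\<sigma>. \<Prod>i=1..N. g i (\<sigma> i))
     = (\<Prod>i=1..N. (exp (u i) * g i 1 + exp (- u i) * g i (-1)) / (exp (u i) + exp (- u i)))"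
proof -
  have weight_external: "spin_weight N h x \<sigma> = (\<Prod>i=1..N. exp (u i * \<sigma> i))" for \<sigma>
    by (rule weight_external) (simp_all add: x_off u)
  have "spin_avg N h x (\<lambda>\<sigma>. \<Prod>i=1..N. g i (\<sigma> i)) = (\<Sum>\<sigma>\<in>configs N. \<Prod>i=1..N. exp (u i * \<sigma> i) * g i (\<sigma> i)) / spin_Z N h x"
    by (simp only: spin_avg_def weight_external prod.distrib sum_divide_distrib times_divide_eq_left)
  also have "spin_Z N h x = (\<Prod>i=1..N. exp (u i) + exp (- u i))"
    unfolding spin_Z_def weight_external
    using sum_configs_prod[of "\<lambda>i s. exp (u i * s)"] by (simp only: mult_1_right mult_minus_right)
  also have "(\<Sum>\<sigma>\<in>configs N. \<Prod>i=1..N. exp (u i * \<sigma> i) * g i (\<sigma> i))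
     = (\<Prod>i=1..N. exp (u i) * g i 1 + exp (- u i) * g i (-1))"
    using sum_configs_prod[of "\<lambda>i s. exp (u i * s) * g i s"]
    by (simp only: mult_1_right mult_minus_right)
  finally show ?thesis unfolding prod_dividef .
qed

lemma avg2_external_exp:
  fixes x :: "nat \<times> nat \<Rightarrow> real"
  assumes x_off: "\<And>i j. i < j \<Longrightarrow> x (i, j) = 0" and u: "\<And>i. u i = x (i, i) + h"
  shows "spin_avg2 N h x (\<lambda>\<sigma> \<tau>. exp (\<Sum>i=1..N. b i * (\<sigma> i * \<tau> i)))
     = (\<Prod>i=1..N. cosh (b i) + sinh (b i) * (tanh (u i))\<^sup>2)"
proof -
  have avg_external_prod: "spin_avg N h x (\<lambda>\<sigma>. \<Prod>i=1..N. g i (\<sigma> i))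
     = (\<Prod>i=1..N. (exp (u i) * g i 1 + exp (- u i) * g i (-1)) / (exp (u i) + exp (- u i)))" for g
    by (rule avg_external_prod) (simp_all add: x_off u)
  define E where "E i = exp (u i) + exp (- u i)" for i
  have inner: "spin_avg N h x (\<lambda>\<tau>. exp (\<Sum>i=1..N. b i * (\<sigma> i * \<tau> i)))
      = (\<Prod>i=1..N. (exp (u i) * exp (b i * \<sigma> i) + exp (- u i) * exp (- (b i * \<sigma> i))) / E i)" for \<sigma>
  proof -
    have "spin_avg N h x (\<lambda>\<tau>. exp (\<Sum>i=1..N. b i * (\<sigma> i * \<tau> i)))
      = spin_avg N h x (\<lambda>\<tau>. \<Prod>i=1..N. (\<lambda>s. exp (b i * (\<sigma> i * s))) (\<tau> i))"
      by (simp only: exp_sum finite_atLeastAtMost)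
    also have "\<dots> = (\<Prod>i=1..N. (exp (u i) * exp (b i * (\<sigma> i * 1)) + exp (- u i) * exp (b i * (\<sigma> i * - 1)))
        / (exp (u i) + exp (- u i)))"
      by (rule avg_external_prod[where g = "\<lambda>i s. exp (b i * (\<sigma> i * s))"])
    finally show ?thesis by (simp only: E_def mult_1_right mult_minus_right)
  qed
  have "spin_avg2 N h x (\<lambda>\<sigma> \<tau>. exp (\<Sum>i=1..N. b i * (\<sigma> i * \<tau> i)))
     = (\<Prod>i=1..N. (exp (u i) * ((exp (u i) * exp (b i) + exp (- u i) * exp (- b i)) / E i)
      + exp (- u i) * ((exp (u i) * exp (- b i) + exp (- u i) * exp (b i)) / E i)) / E i)"
    unfolding inner
    by (subst avg_external_prod[where g = "\<lambda>i s. (exp (u i) * exp (b i * s) + exp (- u i) * exp (- (b i * s))) / E i"])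
      (simp only: E_def mult_1_right mult_minus_right minus_minus)
  also have "\<dots> = (\<Prod>i=1..N. cosh (b i) + sinh (b i) * (tanh (u i))\<^sup>2)"
  proof (rule prod.cong[OF refl])
    fix i
    define e d B B' where "e = exp (u i)" and "d = exp (- u i)" and "B = exp (b i)" and "B' = exp (- b i)"
    have "e + d > 0" unfolding e_def d_def by (intro add_pos_pos) simp_all
    then have s: "e + d \<noteq> 0" by simp
    have "(B + B') / 2 + (B - B') / 2 * ((e - d) / (e + d))\<^sup>2
      = ((B + B') / 2 * (e + d)\<^sup>2 + (B - B') / 2 * (e - d)\<^sup>2) / (e + d)\<^sup>2"
      using s by (simp add: power_divide add_divide_distrib)
    also have "(B + B') / 2 * (e + d)\<^sup>2 + (B - B') / 2 * (e - d)\<^sup>2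
      = e * (e * B + d * B') + d * (e * B' + d * B)"
      by (simp add: power2_eq_square field_simps)
    also have "(e * (e * B + d * B') + d * (e * B' + d * B)) / (e + d)\<^sup>2
      = (e * ((e * B + d * B') / (e + d)) + d * ((e * B' + d * B) / (e + d))) / (e + d)"
      by (simp only: power2_eq_square times_divide_eq_right add_divide_distrib[symmetric] divide_divide_eq_left)
    finally show "(exp (u i) * ((exp (u i) * exp (b i) + exp (- u i) * exp (- b i)) / E i)
      + exp (- u i) * ((exp (u i) * exp (- b i) + exp (- u i) * exp (b i)) / E i)) / E i
       = cosh (b i) + sinh (b i) * (tanh (u i))\<^sup>2"
      by (simp add: E_def cosh_field_def sinh_field_def tanh_altdef e_def d_def B_def B'_def)
  qed
  finally show ?thesis .
qed

text \<open>
  The left side is the exponential moment of a variable with values \<open>1\<close> and \<open>-1\<close> and mean \<open>q\<close>, so this is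
  Hoeffding's lemma.
\<close>
lemma two_point_subgaussian:
  fixes b q :: real
  assumes "\<bar>q\<bar> \<le> 1"
  shows "cosh b + sinh b * q \<le> exp (b * q + b\<^sup>2 / 2)"
proof -
  have pos: "cosh b + sinh b * q \<le> exp (b * q + b\<^sup>2 / 2)" if b: "b \<ge> 0" and q: "\<bar>q\<bar> \<le> 1" for b q :: real
  proof -
    \<comment> \<open>The probability of the value \<open>1\<close>.\<close>
    define p where "p = (1 + q) / 2"
    have p: "0 \<le> p" using q by (auto simp: p_def)
    have e: "exp (2 * b) - 1 \<ge> 0" using b by simp
    have P: "1 + p * (exp (2 * b) - 1) > 0" using p e by (intro add_pos_nonneg mult_nonneg_nonneg) auto
    have "ln (1 + p * (exp (2 * b) - 1)) \<le> b\<^sup>2 / 2 + 2 * b * p"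
      using Hoeffdings_lemma_aux[of "2 * b" p] b p by (simp add: power2_eq_square)
    then have "exp (ln (1 + p * (exp (2 * b) - 1))) \<le> exp (b\<^sup>2 / 2 + 2 * b * p)"
      by (simp only: exp_le_cancel_iff)
    then have "1 + p * (exp (2 * b) - 1) \<le> exp (b\<^sup>2 / 2 + 2 * b * p)"
      by (simp only: exp_ln[OF P])
    then have "exp (- b) * (1 + p * (exp (2 * b) - 1)) \<le> exp (- b) * exp (b\<^sup>2 / 2 + 2 * b * p)"
      by (intro mult_left_mono) auto
    also have "\<dots> = exp (b * q + b\<^sup>2 / 2)"
      by (simp add: p_def field_simps flip: exp_add)
    also have "exp (- b) * (1 + p * (exp (2 * b) - 1)) = cosh b + sinh b * q"
    proof -
      have "exp (- b) * exp (2 * b) = exp b" by (simp flip: exp_add)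
      then have "exp (- b) * (1 + p * (exp (2 * b) - 1)) = exp (- b) + p * (exp b - exp (- b))"
        by (simp add: algebra_simps)
      then show ?thesis by (simp add: p_def cosh_def sinh_def field_simps)
    qed
    finally show ?thesis .
  qed
  show ?thesis
  proof (cases "b \<ge> 0")
    case True
    then show ?thesis using pos assms by blast
  next
    case False
    then show ?thesis using pos[of "- b" "- q"] assms by simp
  qed
qed

text \<open>
  When only random fields act, the products \<open>\<sigma>\<^sub>i \<tau>\<^sub>i\<close> are independent under the field-averaged measure, and the
  equation for \<open>q\<close> says precisely that they have mean \<open>q\<^sub>i\<close>.
\<close>
lemma external_field_subgaussian:
  fixes r q b :: "nat \<Rightarrow> real"
  assumes q: "\<And>i. i \<in> {1..N} \<Longrightarrow> \<bar>q i\<bar> \<le> 1"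
    and fix_q: "\<And>i. i \<in> {1..N} \<Longrightarrow> q i = (\<integral>z. (tanh (r i * z + h))\<^sup>2 \<partial>gaussian)"
    and v: "\<And>i j. v (i, j) = (if i = j then r i else 0)"
  shows "(\<integral>\<xi>. spin_avg2 N h (\<lambda>k. v k * \<xi> k)
        (\<lambda>\<sigma> \<tau>. exp (\<Sum>i=1..N. b i * (\<sigma> i * \<tau> i - q i))) \<partial>gaussian_family (spin_couplings N))
      \<le> exp ((\<Sum>i=1..N. (b i)\<^sup>2) / 2)"
proof -
  interpret G: prob_space gaussian by (rule prob_space_gaussian)
  interpret product_prob_space "\<lambda>_ :: nat \<times> nat. gaussian" UNIV ..
  define F where "F i z = cosh (b i) + sinh (b i) * (tanh (r i * z + h))\<^sup>2" for i z
  define e where "e = exp (- (\<Sum>i=1..N. b i * q i))"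
  have tanh_meas [measurable]: "(\<lambda>z. (tanh (r i * z + h))\<^sup>2) \<in> borel_measurable borel" for i
    by (intro borel_measurable_continuous_onI continuous_intros) auto
  have abs_tanh: "\<bar>tanh z\<bar> < 1" for z :: real
    using tanh_real_lt_1[of z] tanh_real_gt_neg1[of z] by linarith
  have tanh_int: "integrable gaussian (\<lambda>z. (tanh (r i * z + h))\<^sup>2)" for i
    by (intro G.integrable_const_bound[of _ 1]) (auto simp: abs_square_le_1 intro!: less_imp_le abs_tanh)
  have F_int: "integrable gaussian (F i)" for i
    unfolding F_def using tanh_int by simp
  have F_val: "(\<integral>z. F i z \<partial>gaussian) = cosh (b i) + sinh (b i) * q i" if "i \<in> {1..N}" for i
    unfolding F_def using tanh_int fix_q[OF that] G.prob_space by simp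
  have "spin_avg2 N h (\<lambda>k. v k * \<xi> k) (\<lambda>\<sigma> \<tau>. exp (\<Sum>i=1..N. b i * (\<sigma> i * \<tau> i - q i)))
      = e * (\<Prod>k\<in>spin_couplings N. (if fst k = snd k then F (fst k) else (\<lambda>_. 1)) (\<xi> k))" for \<xi>
  proof -
    have split: "exp (\<Sum>i=1..N. b i * (\<sigma> i * \<tau> i - q i)) = e * exp (\<Sum>i=1..N. b i * (\<sigma> i * \<tau> i))" for \<sigma> \<tau>
      unfolding e_def exp_add[symmetric] right_diff_distrib sum_subtractf by simp
    have "spin_avg2 N h (\<lambda>k. v k * \<xi> k) (\<lambda>\<sigma> \<tau>. exp (\<Sum>i=1..N. b i * (\<sigma> i * \<tau> i)))
      = (\<Prod>i=1..N. cosh (b i) + sinh (b i) * (tanh (v (i, i) * \<xi> (i, i) + h))\<^sup>2)"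
      by (rule avg2_external_exp) (simp_all add: v)
    also have "\<dots> = (\<Prod>i=1..N. F i (\<xi> (i, i)))"
      by (simp only: F_def v if_True refl)
    finally have "spin_avg2 N h (\<lambda>k. v k * \<xi> k) (\<lambda>\<sigma> \<tau>. exp (\<Sum>i=1..N. b i * (\<sigma> i * \<tau> i - q i)))
      = e * (\<Prod>i=1..N. F i (\<xi> (i, i)))"
      by (simp only: split spin_avg_cmult)
    also have "(\<Prod>i=1..N. F i (\<xi> (i, i))) = (\<Prod>k\<in>(\<lambda>i. (i, i)) ` {1..N}. F (fst k) (\<xi> k))"
      by (subst prod.reindex) (auto simp: inj_on_def)
    also have "\<dots> = (\<Prod>k\<in>(\<lambda>i. (i, i)) ` {1..N}. (if fst k = snd k then F (fst k) else (\<lambda>_. 1)) (\<xi> k))"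
      by (rule prod.cong) auto
    also have "\<dots> = (\<Prod>k\<in>spin_couplings N. (if fst k = snd k then F (fst k) else (\<lambda>_. 1)) (\<xi> k))"
      by (intro prod.mono_neutral_left finite_spin_couplings) (auto simp: spin_couplings_def)
    finally show ?thesis .
  qed
  note expand = this
  have "(\<integral>\<xi>. spin_avg2 N h (\<lambda>k. v k * \<xi> k) (\<lambda>\<sigma> \<tau>. exp (\<Sum>i=1..N. b i * (\<sigma> i * \<tau> i - q i)))
        \<partial>gaussian_family (spin_couplings N))
      = e * (\<Prod>k\<in>spin_couplings N. \<integral>z. (if fst k = snd k then F (fst k) else (\<lambda>_. 1)) z \<partial>gaussian)"
    unfolding expand integral_mult_right_zero
    by (subst product_integral_prod) (auto simp: finite_spin_couplings F_int)
  also have "(\<Prod>k\<in>spin_couplings N. \<integral>z. (if fst k = snd k then F (fst k) else (\<lambda>_. 1)) z \<partial>gaussian)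
      = (\<Prod>k\<in>(\<lambda>i. (i, i)) ` {1..N}. \<integral>z. F (fst k) z \<partial>gaussian)"
  proof (rule prod.mono_neutral_cong_right[OF finite_spin_couplings])
    show "(\<lambda>i. (i, i)) ` {1..N} \<subseteq> spin_couplings N" by (auto simp: spin_couplings_def)
    show "\<forall>k\<in>spin_couplings N - (\<lambda>i. (i, i)) ` {1..N}.
        (\<integral>z. (if fst k = snd k then F (fst k) else (\<lambda>_. 1)) z \<partial>gaussian) = 1"
    proof
      fix k assume k: "k \<in> spin_couplings N - (\<lambda>i. (i, i)) ` {1..N}"
      obtain i j where ij: "k = (i, j)" by (cases k)
      with k have "i \<noteq> j" by (cases "i = j") (auto simp: spin_couplings_def)
      then show "(\<integral>z. (if fst k = snd k then F (fst k) else (\<lambda>_. 1)) z \<partial>gaussian) = 1"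
        using ij G.prob_space by simp
    qed
    show "(\<integral>z. (if fst k = snd k then F (fst k) else (\<lambda>_. 1)) z \<partial>gaussian) = (\<integral>z. F (fst k) z \<partial>gaussian)"
      if "k \<in> (\<lambda>i. (i, i)) ` {1..N}" for k
      using that by auto
  qed
  also have "\<dots> = (\<Prod>i=1..N. cosh (b i) + sinh (b i) * q i)"
    using F_val by (subst prod.reindex) (auto simp: inj_on_def)
  also have "e * \<dots> \<le> e * (\<Prod>i=1..N. exp (b i * q i + (b i)\<^sup>2 / 2))"
  proof (intro mult_left_mono prod_mono conjI)
    fix i assume i: "i \<in> {1..N}"
    show "cosh (b i) + sinh (b i) * q i \<le> exp (b i * q i + (b i)\<^sup>2 / 2)"
      by (rule two_point_subgaussian[OF q[OF i]])
    have "\<bar>sinh (b i) * q i\<bar> \<le> cosh (b i) * 1"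
      unfolding abs_mult using q[OF i]
      by (intro mult_mono) (auto simp: abs_le_iff sinh_def cosh_def)
    then show "0 \<le> cosh (b i) + sinh (b i) * q i" by linarith
  qed (simp add: e_def)
  also have "\<dots> = exp ((\<Sum>i=1..N. (b i)\<^sup>2) / 2)"
    unfolding e_def exp_sum[OF finite_atLeastAtMost, symmetric] exp_add[symmetric] sum.distrib
      sum_divide_distrib by simp
  finally show ?thesis .
qed

section \<open>Quadratic exponents of sub-Gaussian vectors\<close>

text \<open>
  In the eigenbasis the exponent is a sum of squares, and \<open>exp (k\<^sup>2 Y\<^sup>2 / 2)\<close> is the mean of \<open>exp (k Y z)\<close> over a
  standard Gaussian \<open>z\<close>. This makes the exponent linear in \<open>y\<close>, so the assumed bound applies for each
  fixed \<open>z\<close>. What remains is the mean of \<open>exp (c e\<^sub>i z\<^sub>i\<^sup>2)\<close>.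
\<close>
lemma gaussian_linearization:
  fixes W :: "'a \<Rightarrow> real" and y :: "'a \<Rightarrow> real ^ 'm::finite" and e :: "real ^ 'm"
  assumes fin: "finite A"
    and sub: "\<And>v. (\<Sum>a\<in>A. W a * exp (v \<bullet> y a)) \<le> exp (v \<bullet> v / 2)"
    and U: "orthogonal_matrix U" and e: "\<And>i. e $ i \<ge> 0" and c: "c \<ge> 0"
    and ce: "\<And>i. 2 * c * e $ i < 1"
  shows "(\<Sum>a\<in>A. W a * exp (c * (\<Sum>i\<in>UNIV. e $ i * ((transpose U *v y a) $ i)\<^sup>2)))
     \<le> (\<Prod>i\<in>UNIV. (1 - 2 * c * e $ i) powr (-1/2))"
proof -
  interpret G: prob_space gaussian by (rule prob_space_gaussian)
  interpret product_prob_space "\<lambda>_ :: 'm. gaussian" UNIV ..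
  let ?P = "gaussian_family (UNIV :: 'm set)"
  have adj: "(U *v w) \<bullet> x = w \<bullet> (transpose U *v x)" for w x
    by (simp only: inner_matrix_vector_mult[of w "transpose U" x] transpose_transpose)
  define k where "k i = sqrt (2 * c * e $ i)" for i
  have k2: "(k i)\<^sup>2 = 2 * (c * e $ i)" for i using e c by (simp add: k_def)
  define Y where "Y a = transpose U *v y a" for a
  define v where "v z = U *v (\<chi> i. k i * z i)" for z
  have vy: "v z \<bullet> y a = (\<Sum>i\<in>UNIV. k i * Y a $ i * z i)" for z a
  proof -
    have "v z \<bullet> y a = (\<chi> i. k i * z i) \<bullet> Y a"
      by (simp add: v_def Y_def adj)
    then show ?thesis by (simp add: inner_vec_def mult_ac)
  qed
  have vv: "v z \<bullet> v z = (\<Sum>i\<in>UNIV. 2 * (c * e $ i) * (z i)\<^sup>2)" for z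
  proof -
    have "v z \<bullet> v z = (\<chi> i. k i * z i) \<bullet> (transpose U *v (U *v (\<chi> i. k i * z i)))"
      by (simp add: v_def adj)
    also have "\<dots> = (\<chi> i. k i * z i) \<bullet> (\<chi> i. k i * z i)"
      using U by (simp add: matrix_vector_mul_assoc orthogonal_matrix_def)
    also have "\<dots> = (\<Sum>i\<in>UNIV. (k i * z i)\<^sup>2)" by (simp add: inner_vec_def power2_eq_square)
    finally show ?thesis by (simp add: power_mult_distrib k2)
  qed
  have lin: "integrable ?P (\<lambda>z. exp (v z \<bullet> y a))"
    "exp (c * (\<Sum>i\<in>UNIV. e $ i * (Y a $ i)\<^sup>2)) = (\<integral>z. exp (v z \<bullet> y a) \<partial>?P)" for a
  proof -
    have *: "exp (v z \<bullet> y a) = (\<Prod>i\<in>UNIV. exp (k i * Y a $ i * z i))" for z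
      by (simp add: vy exp_sum)
    show "integrable ?P (\<lambda>z. exp (v z \<bullet> y a))"
      unfolding * by (intro product_integrable_prod gaussian_exp_linear) simp
    have "(\<integral>z. exp (v z \<bullet> y a) \<partial>?P) = (\<Prod>i\<in>UNIV. exp ((k i * Y a $ i)\<^sup>2 / 2))"
      unfolding * by (subst product_integral_prod) (simp_all add: gaussian_exp_linear)
    also have "\<dots> = exp (\<Sum>i\<in>UNIV. c * (e $ i * (Y a $ i)\<^sup>2))"
      by (simp add: exp_sum power_mult_distrib k2 mult_ac)
    finally show "exp (c * (\<Sum>i\<in>UNIV. e $ i * (Y a $ i)\<^sup>2)) = (\<integral>z. exp (v z \<bullet> y a) \<partial>?P)"
      by (simp add: sum_distrib_left)
  qed
  have sq: "exp (v z \<bullet> v z / 2) = (\<Prod>i\<in>UNIV. exp (c * e $ i * (z i)\<^sup>2))" for z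
    by (simp add: vv exp_sum[symmetric] sum_divide_distrib mult.assoc)
  have ce': "2 * (c * e $ i) < 1" for i using ce[of i] by (simp add: mult_ac)
  have "(\<Sum>a\<in>A. W a * exp (c * (\<Sum>i\<in>UNIV. e $ i * (Y a $ i)\<^sup>2)))
     = (\<integral>z. (\<Sum>a\<in>A. W a * exp (v z \<bullet> y a)) \<partial>?P)"
    using lin by simp
  also have "\<dots> \<le> (\<integral>z. exp (v z \<bullet> v z / 2) \<partial>?P)"
    using sub lin(1) unfolding sq[symmetric]
  proof (intro integral_mono Bochner_Integration.integrable_sum integrable_mult_right)
    show "integrable ?P (\<lambda>z. exp (v z \<bullet> v z / 2))"
      unfolding sq by (intro product_integrable_prod gaussian_exp_square ce') simp
  qed auto
  also have "\<dots> = (\<Prod>i\<in>UNIV. (1 - 2 * (c * e $ i)) powr (-1/2))"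
    unfolding sq using gaussian_exp_square[OF ce'] by (subst product_integral_prod) auto
  finally show ?thesis by (simp add: Y_def mult.assoc)
qed

section \<open>The disorder as a standard Gaussian family\<close>

definition coupling_vector :: "nat \<Rightarrow> real \<Rightarrow> (nat \<times> nat \<Rightarrow> real) \<Rightarrow> nat \<times> nat \<Rightarrow> real" where
  "coupling_vector N \<beta> x k = (if fst k < snd k then \<beta> / sqrt (real N) * x k else 0)"

lemma finite_site_pairs: "finite (site_pairs N)"
  by (rule finite_subset[of _ "{1..N} \<times> {1..N}"]) (auto simp: site_pairs_def)

lemma gibbs_avg_eq_avg2:
  fixes x :: "nat \<times> nat \<Rightarrow> real"
  shows "gibbs_avg N \<beta> h (\<lambda>i j. x (i, j)) f
    = spin_avg2 N h (coupling_vector N \<beta> x) f"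
proof -
  let ?X = "coupling_vector N \<beta> x"
  have "(\<Sum>k\<in>spin_couplings N. ?X k * spin_monomial k \<sigma>) = (\<Sum>k\<in>site_pairs N. ?X k * spin_monomial k \<sigma>)" for \<sigma>
  proof (rule sum.mono_neutral_right[OF finite_spin_couplings])
    show "site_pairs N \<subseteq> spin_couplings N" by (auto simp: site_pairs_def spin_couplings_def)
    show "\<forall>k\<in>spin_couplings N - site_pairs N. ?X k * spin_monomial k \<sigma> = 0"
      by (auto simp: site_pairs_def spin_couplings_def coupling_vector_def)
  qed
  moreover have "(\<Sum>k\<in>site_pairs N. ?X k * spin_monomial k \<sigma>)
      = \<beta> / sqrt (real N) * (\<Sum>(i, j)\<in>site_pairs N. x (i, j) * \<sigma> i * \<sigma> j)" for \<sigma>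
    unfolding sum_distrib_left
    by (rule sum.cong) (auto simp: site_pairs_def coupling_vector_def spin_monomial_def)
  ultimately have w: "exp (hamiltonian N \<beta> h (\<lambda>i j. x (i, j)) \<sigma>) = spin_weight N h ?X \<sigma>" for \<sigma>
    by (simp add: hamiltonian_def spin_weight_def field_weight_def exp_add)
  show ?thesis
    unfolding gibbs_avg_def gibbs_def partition_fn_def w spin_avg_def spin_Z_def[symmetric] sum_distrib_left
    by (simp only: mult.assoc)
qed

text \<open>
  The Gibbs average depends on the disorder through the couplings of the site pairs only, and these have the
  same joint law as scaled coordinates of a standard Gaussian family. The family may have further coordinates,
  which is what allows the random fields to be added on the same space.
\<close>
lemma nu_eq_gaussian_integral:
  fixes D :: "real ^ 'm ^ 'm::finite" and Sp :: "'m \<Rightarrow> nat set" and sp :: "nat \<Rightarrow> 'm"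
  assumes dis: "gaussian_disorder M N Sp D g" and ne: "site_pairs N \<noteq> {}"
    and sp: "\<And>i. i \<in> {1..N} \<Longrightarrow> i \<in> Sp (sp i)"
    and u: "\<And>i j. u (i, j) = (if i < j then \<beta> / sqrt (real N) * sqrt (D $ sp i $ sp j) else 0)"
  shows "nu M N \<beta> h g f = (\<integral>\<xi>.
     spin_avg2 N h (\<lambda>k. u k * \<xi> k) f
      \<partial>gaussian_family (spin_couplings N))"
proof -
  interpret PM: prob_space M using dis by (simp add: gaussian_disorder_def)
  let ?K = "spin_couplings N" and ?J = "site_pairs N" and ?P = "gaussian_family (spin_couplings N)"
  interpret PK: prob_space ?P by (rule prob_space_gaussian_family)
  interpret GG: product_prob_space "\<lambda>_ :: nat \<times> nat. gaussian" ?K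
    by (rule product_prob_spaceI) (rule prob_space_gaussian)
  have JK: "?J \<subseteq> ?K" by (auto simp: site_pairs_def spin_couplings_def)
  define X where "X = (\<lambda>(i, j). g i j)"
  define v where "v k = D $ sp (fst k) $ sp (snd k)" for k :: "nat \<times> nat"
  define Y where "Y k \<xi> = sqrt (v k) * \<xi> k" for k and \<xi> :: "nat \<times> nat \<Rightarrow> real"
  have indX: "PM.indep_vars (\<lambda>_. borel) X ?J"
    using dis by (simp add: gaussian_disorder_def X_def)
  then have mX: "X k \<in> borel_measurable M" if "k \<in> ?J" for k
    using that by (simp add: PM.indep_vars_def)
  have dX: "distr M borel (X k) = centered_gaussian (v k)" if k: "k \<in> ?J" for k
  proof -
    obtain i j where ij: "k = (i, j)" by (cases k)
    then have "i \<in> Sp (sp i)" "j \<in> Sp (sp j)" using sp k by (auto simp: site_pairs_def)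
    then show ?thesis using dis k ij by (auto simp: gaussian_disorder_def X_def v_def)
  qed
  have mcomp: "(\<lambda>\<xi>. \<xi> k) \<in> measurable ?P gaussian" if "k \<in> ?J" for k
    using that JK by (intro measurable_component_singleton) auto
  have mY: "Y k \<in> borel_measurable ?P" if "k \<in> ?J" for k
    unfolding Y_def using borel_measurable_gaussian_component[of k ?K] that JK by (auto simp: Y_def)
  have dcomp: "distr ?P gaussian (\<lambda>\<xi>. \<xi> k) = gaussian" if "k \<in> ?J" for k
    using that JK by (intro distr_PiM_component prob_space_gaussian) auto
  have dY: "distr ?P borel (Y k) = centered_gaussian (v k)" if "k \<in> ?J" for k
  proof -
    have "distr (distr ?P gaussian (\<lambda>\<xi>. \<xi> k)) borel (\<lambda>z. sqrt (v k) * z) = distr ?P borel (Y k)"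
      by (subst distr_distr[OF _ mcomp[OF that]]) (auto simp: comp_def Y_def[abs_def])
    then show ?thesis by (simp add: dcomp[OF that] centered_gaussian_def)
  qed
  have "PK.indep_vars (\<lambda>_. gaussian) (\<lambda>k \<xi>. \<xi> k) ?J"
  proof (subst PK.indep_vars_iff_distr_eq_PiM'[OF ne mcomp], assumption)
    have "distr ?P (gaussian_family ?J) (\<lambda>\<xi>. restrict \<xi> ?J) = gaussian_family ?J"
      by (rule GG.distr_PiM_restrict_finite[OF finite_site_pairs JK])
    also have "\<dots> = PiM ?J (\<lambda>k. distr ?P gaussian (\<lambda>\<xi>. \<xi> k))"
      by (intro PiM_cong refl) (simp add: dcomp)
    finally show "distr ?P (gaussian_family ?J) (\<lambda>\<xi>. \<lambda>k\<in>?J. \<xi> k) = PiM ?J (\<lambda>k. distr ?P gaussian (\<lambda>\<xi>. \<xi> k))"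
      by (simp add: restrict_def)
  qed
  then have indY: "PK.indep_vars (\<lambda>_. borel) Y ?J"
    unfolding Y_def[abs_def] by (rule PK.indep_vars_compose2) auto
  let ?B = "PiM ?J (\<lambda>_. borel) :: (nat \<times> nat \<Rightarrow> real) measure"
  have law: "distr M ?B (\<lambda>\<omega>. \<lambda>k\<in>?J. X k \<omega>) = distr ?P ?B (\<lambda>\<xi>. \<lambda>k\<in>?J. Y k \<xi>)"
  proof -
    have "distr M ?B (\<lambda>\<omega>. \<lambda>k\<in>?J. X k \<omega>) = PiM ?J (\<lambda>k. distr M borel (X k))"
      by (rule iffD1[OF PM.indep_vars_iff_distr_eq_PiM'[where M' = "\<lambda>_. borel" and X = X, OF ne mX] indX])
    also have "\<dots> = PiM ?J (\<lambda>k. distr ?P borel (Y k))"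
      by (intro PiM_cong refl) (simp add: dX dY)
    also have "\<dots> = distr ?P ?B (\<lambda>\<xi>. \<lambda>k\<in>?J. Y k \<xi>)"
      using PK.indep_vars_iff_distr_eq_PiM'[where M' = "\<lambda>_. borel" and X = Y, OF ne mY] indY by (simp add: eq_commute)
    finally show ?thesis .
  qed
  define G where "G x = gibbs_avg N \<beta> h (\<lambda>i j. x (i, j)) f" for x :: "nat \<times> nat \<Rightarrow> real"
  have G_cong: "G x = G x'" if "\<And>k. k \<in> ?J \<Longrightarrow> x k = x' k" for x x'
  proof -
    have "hamiltonian N \<beta> h (\<lambda>i j. x (i, j)) = hamiltonian N \<beta> h (\<lambda>i j. x' (i, j))"
      unfolding hamiltonian_def using that by (intro ext arg_cong2[where f = "(+)"] arg_cong2[where f = "(*)"] sum.cong refl) auto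
    then show ?thesis by (simp add: G_def gibbs_avg_def gibbs_def partition_fn_def)
  qed
  have mG: "G \<in> borel_measurable ?B"
  proof -
    have "(\<lambda>x. coupling_vector N \<beta> x k) \<in> borel_measurable ?B" if "k \<in> ?K" for k
    proof (cases "fst k < snd k")
      case True
      then have "k \<in> ?J" using that by (cases k) (auto simp: spin_couplings_def site_pairs_def)
      then have "(\<lambda>x. x k) \<in> borel_measurable ?B" by (rule measurable_component_singleton)
      then show ?thesis unfolding coupling_vector_def using True by simp
    qed (simp add: coupling_vector_def)
    then show ?thesis
      unfolding G_def gibbs_avg_eq_avg2 by (intro finite_gibbs.borel_measurable_avg[OF finite_gibbs_spin]) auto
  qed
  have mrX: "(\<lambda>\<omega>. \<lambda>k\<in>?J. X k \<omega>) \<in> measurable M ?B" by (rule measurable_restrict) (rule mX)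
  have mrY: "(\<lambda>\<xi>. \<lambda>k\<in>?J. Y k \<xi>) \<in> measurable ?P ?B" by (rule measurable_restrict) (rule mY)
  have "nu M N \<beta> h g f = (\<integral>\<omega>. G (\<lambda>k. X k \<omega>) \<partial>M)"
    by (simp add: nu_def G_def X_def)
  also have "\<dots> = (\<integral>\<omega>. G (\<lambda>k\<in>?J. X k \<omega>) \<partial>M)"
    by (intro Bochner_Integration.integral_cong refl G_cong) simp
  also have "\<dots> = (\<integral>x. G x \<partial>distr M ?B (\<lambda>\<omega>. \<lambda>k\<in>?J. X k \<omega>))"
    by (rule integral_distr[OF mrX mG, symmetric])
  also have "\<dots> = (\<integral>\<xi>. G (\<lambda>k\<in>?J. Y k \<xi>) \<partial>?P)"
    unfolding law by (rule integral_distr[OF mrY mG])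
  also have "\<dots> = (\<integral>\<xi>. G (\<lambda>k. Y k \<xi>) \<partial>?P)"
    by (intro Bochner_Integration.integral_cong refl G_cong) simp
  also have "\<dots> = (\<integral>\<xi>. spin_avg2 N h (\<lambda>k. u k * \<xi> k) f \<partial>?P)"
  proof -
    have "coupling_vector N \<beta> (\<lambda>k. Y k \<xi>) = (\<lambda>k. u k * \<xi> k)" for \<xi>
    proof
      fix k show "coupling_vector N \<beta> (\<lambda>k. Y k \<xi>) k = u k * \<xi> k"
        by (cases k) (simp add: coupling_vector_def Y_def v_def u)
    qed
    then have "G (\<lambda>k. Y k \<xi>) = spin_avg2 N h (\<lambda>k. u k * \<xi> k) f" for \<xi>
      using gibbs_avg_eq_avg2[of N \<beta> h "\<lambda>k. Y k \<xi>" f] by (simp only: G_def)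
    then show ?thesis by simp
  qed
  finally show ?thesis .
qed

section \<open>Sums over species and the covariance of the Hamiltonian\<close>

lemma sum_symmetric_pairs:
  fixes F :: "nat \<Rightarrow> nat \<Rightarrow> real"
  assumes sym: "\<And>i j. F i j = F j i"
  shows "(\<Sum>i=1..N. \<Sum>j=1..N. F i j) = 2 * (\<Sum>(i, j)\<in>site_pairs N. F i j) + (\<Sum>i=1..N. F i i)"
proof -
  let ?F = "\<lambda>(i, j). F i j"
  let ?J = "site_pairs N" and ?J' = "(\<lambda>(i, j). (j, i)) ` site_pairs N" and ?d = "(\<lambda>i. (i, i)) ` {1..N}"
  have "{1..N} \<times> {1..N} = (?J \<union> ?J') \<union> ?d"
    by (auto simp: site_pairs_def image_iff)
  moreover have "(\<Sum>k\<in>(?J \<union> ?J') \<union> ?d. ?F k) = (\<Sum>k\<in>?J. ?F k) + (\<Sum>k\<in>?J'. ?F k) + (\<Sum>k\<in>?d. ?F k)"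
    by (subst sum.union_disjoint, (use finite_site_pairs in \<open>auto simp: site_pairs_def\<close>)[3],
        subst sum.union_disjoint) (use finite_site_pairs in \<open>auto simp: site_pairs_def\<close>)
  moreover have "(\<Sum>k\<in>?J'. ?F k) = (\<Sum>k\<in>?J. ?F k)"
    by (subst sum.reindex) (auto simp: inj_on_def sym intro!: sum.cong)
  moreover have "(\<Sum>k\<in>?d. ?F k) = (\<Sum>i=1..N. F i i)"
    by (subst sum.reindex) (auto simp: inj_on_def)
  ultimately show ?thesis by (simp add: sum.cartesian_product)
qed

lemma sum_over_species:
  fixes F :: "nat \<Rightarrow> real"
  assumes "species_partition N Sp"
  shows "(\<Sum>i=1..N. F i) = (\<Sum>s\<in>UNIV. \<Sum>i\<in>Sp s. F i)"
proof -
  have "finite (Sp s)" for s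
    using assms by (intro finite_subset[of "Sp s" "{1..N}"]) (auto simp: species_partition_def)
  then have "sum F (\<Union>s. Sp s) = (\<Sum>s\<in>UNIV. \<Sum>i\<in>Sp s. F i)"
    using assms by (intro sum.UNION_disjoint) (auto simp: species_partition_def disjoint_family_on_def)
  then show ?thesis using assms by (simp add: species_partition_def)
qed

text \<open>
  This separates the random weights from the observable, so that bounds for sums with fixed weights apply to
  averages over the couplings.
\<close>
lemma (in finite_gibbs) integral_avg2_eq_sum:
  assumes M: "prob_space M" and X: "\<And>k. k \<in> K \<Longrightarrow> (\<lambda>\<xi>. X \<xi> k) \<in> borel_measurable M"
  shows "(\<integral>\<xi>. avg2 (X \<xi>) F \<partial>M) = (\<Sum>a\<in>C \<times> C.
     (\<integral>\<xi>. weight (X \<xi>) (fst a) / Z (X \<xi>) * (weight (X \<xi>) (snd a) / Z (X \<xi>)) \<partial>M) * F (fst a) (snd a))"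
proof -
  interpret M: prob_space M by (rule M)
  have mw: "(\<lambda>\<xi>. weight (X \<xi>) \<sigma> / Z (X \<xi>)) \<in> borel_measurable M" for \<sigma>
    unfolding Z_def weight_def using X by measurable
  have bw: "0 \<le> weight x \<sigma> / Z x" "weight x \<sigma> / Z x \<le> 1" if "\<sigma> \<in> C" for x \<sigma>
    using weight_pos[OF that, of x] Z_pos[of x] member_le_sum[OF that, of "weight x"] finC
    by (auto simp: Z_def intro: less_imp_le weight_pos)
  have int: "integrable M (\<lambda>\<xi>. weight (X \<xi>) (fst a) / Z (X \<xi>) * (weight (X \<xi>) (snd a) / Z (X \<xi>)))"
    if a: "a \<in> C \<times> C" for a
  proof (rule M.integrable_const_bound[of _ 1])
    have C: "fst a \<in> C" "snd a \<in> C" using a by auto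
    show "AE \<xi> in M. norm (weight (X \<xi>) (fst a) / Z (X \<xi>) * (weight (X \<xi>) (snd a) / Z (X \<xi>))) \<le> 1"
    proof (rule AE_I2)
      fix \<xi>
      have "weight (X \<xi>) (fst a) / Z (X \<xi>) * (weight (X \<xi>) (snd a) / Z (X \<xi>)) \<le> 1 * 1"
        by (intro mult_mono bw C) auto
      then show "norm (weight (X \<xi>) (fst a) / Z (X \<xi>) * (weight (X \<xi>) (snd a) / Z (X \<xi>))) \<le> 1"
        using bw(1)[OF C(1)] bw(1)[OF C(2)] by (simp only: real_norm_def abs_of_nonneg mult_nonneg_nonneg)
    qed
  qed (intro borel_measurable_times mw)
  have "avg2 x F = (\<Sum>a\<in>C \<times> C. weight x (fst a) / Z x * (weight x (snd a) / Z x) * F (fst a) (snd a))" for x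
    by (simp only: avg_def sum_distrib_left sum.cartesian_product mult.assoc case_prod_unfold)
  then show ?thesis
    using int by (simp only: Bochner_Integration.integral_sum integrable_mult_left integral_mult_left_zero)
qed

lemma transpose_diag: "transpose (diag d) = diag d"
  by (auto simp: vec_eq_iff transpose_def diag_def)

lemma inner_diag_mult: "(x :: real ^ 'm::finite) \<bullet> (diag d *v y) = (diag d *v x) \<bullet> y"
  by (simp add: inner_vec_def diag_mult_vec mult_ac)

lemma inner_symmetric_mult:
  "transpose D = D \<Longrightarrow> (x :: real ^ 'm::finite) \<bullet> (D *v y) = (D *v x) \<bullet> y"
  using inner_matrix_vector_mult[of x D y] by simp

text \<open>
  The all-ones vector gives the quadratic form a positive value, so a form that is not indefinite has no negative value.
\<close>
lemma not_indefinite_imp_psd: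
  fixes D :: "real ^ 'm ^ 'm::finite"
  assumes nonneg: "\<And>s t. D $ s $ t \<ge> 0" and "D \<noteq> 0" and "\<not> indefinite D"
  shows "x \<bullet> (D *v x) \<ge> 0"
proof -
  obtain s t where "D $ s $ t \<noteq> 0" using \<open>D \<noteq> 0\<close> by (auto simp: vec_eq_iff)
  then have pos: "D $ s $ t > 0" using nonneg[of s t] by simp
  define o1 :: "real ^ 'm" where "o1 = (\<chi> i. 1)"
  have "D $ s $ t \<le> (\<Sum>t\<in>UNIV. D $ s $ t)" by (rule member_le_sum) (auto simp: nonneg)
  also have "\<dots> \<le> (\<Sum>s\<in>UNIV. \<Sum>t\<in>UNIV. D $ s $ t)"
    by (rule member_le_sum[of s UNIV "\<lambda>s. \<Sum>t\<in>UNIV. D $ s $ t"]) (auto simp: nonneg intro: sum_nonneg)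
  also have "\<dots> = o1 \<bullet> (D *v o1)"
    by (simp add: inner_vec_def matrix_vector_mult_def o1_def)
  finally have "o1 \<bullet> (D *v o1) > 0" using pos by simp
  then have "\<not> x \<bullet> (D *v x) < 0" using \<open>\<not> indefinite D\<close> unfolding indefinite_def by blast
  then show ?thesis by simp
qed

locale species =
  fixes N :: nat and Sp :: "'m::finite \<Rightarrow> nat set" and sp :: "nat \<Rightarrow> 'm"
  assumes part: "species_partition N Sp"
    and sp: "\<And>i s. i \<in> Sp s \<Longrightarrow> sp i = s"
begin

lemma Sp_subset: "Sp s \<subseteq> {1..N}"
  using part by (auto simp: species_partition_def)

lemma finite_Sp: "finite (Sp s)"
  using Sp_subset by (rule finite_subset) simp

lemma card_Sp_pos: "card (Sp s) > 0"
  using part finite_Sp by (auto simp: species_partition_def card_gt_0_iff)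

lemma N_pos: "N > 0"
  using Sp_subset card_Sp_pos[of undefined] by (cases N) auto

lemma sp_mem: "i \<in> {1..N} \<Longrightarrow> i \<in> Sp (sp i)"
proof -
  assume "i \<in> {1..N}"
  then have "i \<in> (\<Union>s. Sp s)" using part by (simp add: species_partition_def)
  then obtain s where "i \<in> Sp s" by blast
  then show ?thesis using sp by simp
qed

lemma ratio_pos: "species_ratio N Sp $ s > 0"
  using card_Sp_pos N_pos by (simp add: species_ratio_def)

definition spin_sum :: "(nat \<Rightarrow> real) \<Rightarrow> (nat \<Rightarrow> real) \<Rightarrow> real ^ 'm" where
  "spin_sum \<sigma> \<tau> = (\<chi> s. \<Sum>i\<in>Sp s. \<sigma> i * \<tau> i)"

definition mean_sum :: "real ^ 'm \<Rightarrow> real ^ 'm" where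
  "mean_sum q = (\<chi> s. real (card (Sp s)) * q $ s)"

lemma sum_species: "(\<Sum>i=1..N. F (sp i) i) = (\<Sum>s\<in>UNIV. \<Sum>i\<in>Sp s. F s i)" for F :: "'m \<Rightarrow> nat \<Rightarrow> real"
  unfolding sum_over_species[OF part] using sp by simp

lemma Lam_mult_overlap:
  "Lam N Sp *v (overlap Sp \<sigma> \<tau> - q) = (1 / real N) *\<^sub>R (spin_sum \<sigma> \<tau> - mean_sum q)"
proof -
  have "n / real N * (e / n - r) = (e - n * r) / real N" if "n \<noteq> 0" for n e r :: real
    using that by (simp add: right_diff_distrib diff_divide_distrib)
  then show ?thesis
    using card_Sp_pos
    by (simp add: vec_eq_iff Lam_def diag_mult_vec species_ratio_def overlap_def spin_sum_def
        mean_sum_def)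
qed

lemma Lam_mult_mean: "Lam N Sp *v q = (1 / real N) *\<^sub>R mean_sum q"
  by (simp add: vec_eq_iff Lam_def diag_mult_vec species_ratio_def mean_sum_def)

lemma pair_sum_eq:
  fixes D :: "real ^ 'm ^ 'm"
  shows "(\<Sum>i=1..N. \<Sum>j=1..N. D $ sp i $ sp j * (\<sigma> i * \<tau> i) * (\<sigma> j * \<tau> j))
    = spin_sum \<sigma> \<tau> \<bullet> (D *v spin_sum \<sigma> \<tau>)"
proof -
  have "(\<Sum>i=1..N. \<Sum>j=1..N. D $ sp i $ sp j * (\<sigma> i * \<tau> i) * (\<sigma> j * \<tau> j))
     = (\<Sum>s\<in>UNIV. \<Sum>i\<in>Sp s. \<Sum>t\<in>UNIV. \<Sum>j\<in>Sp t. D $ s $ t * (\<sigma> i * \<tau> i) * (\<sigma> j * \<tau> j))"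
    by (subst sum_species[of "\<lambda>t j. D $ sp i $ t * (\<sigma> i * \<tau> i) * (\<sigma> j * \<tau> j)" for i],
        rule sum_species[of "\<lambda>s i. \<Sum>t\<in>UNIV. \<Sum>j\<in>Sp t. D $ s $ t * (\<sigma> i * \<tau> i) * (\<sigma> j * \<tau> j)"])
  also have "\<dots> = (\<Sum>s\<in>UNIV. (\<Sum>i\<in>Sp s. \<sigma> i * \<tau> i) * (\<Sum>t\<in>UNIV. D $ s $ t * (\<Sum>j\<in>Sp t. \<sigma> j * \<tau> j)))"
  proof (rule sum.cong[OF refl])
    fix s
    have "(\<Sum>t\<in>UNIV. \<Sum>j\<in>Sp t. D $ s $ t * (\<sigma> i * \<tau> i) * (\<sigma> j * \<tau> j))
        = (\<sigma> i * \<tau> i) * (\<Sum>t\<in>UNIV. D $ s $ t * (\<Sum>j\<in>Sp t. \<sigma> j * \<tau> j))" for i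
      by (simp add: sum_distrib_left mult_ac)
    then show "(\<Sum>i\<in>Sp s. \<Sum>t\<in>UNIV. \<Sum>j\<in>Sp t. D $ s $ t * (\<sigma> i * \<tau> i) * (\<sigma> j * \<tau> j))
        = (\<Sum>i\<in>Sp s. \<sigma> i * \<tau> i) * (\<Sum>t\<in>UNIV. D $ s $ t * (\<Sum>j\<in>Sp t. \<sigma> j * \<tau> j))"
      by (simp only: sum_distrib_right)
  qed
  finally show ?thesis
    by (simp add: inner_vec_def matrix_vector_mult_def spin_sum_def)
qed

text \<open>
  Two replicas of the SK Hamiltonian with disorder have covariance \<open>\<beta>\<^sup>2 N / 2\<close> times a quadratic form in the
  overlap, up to a constant from the diagonal \<open>i = j\<close>. The covariance of the random fields is linear in the
  overlap, with the coefficients of the first-order Taylor expansion of that form at \<open>q\<close>. Their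
  difference is thus the same form evaluated at the overlap minus \<open>q\<close>, plus a constant.
\<close>
lemma covariance_difference:
  fixes D :: "real ^ 'm ^ 'm"
  assumes sym: "transpose D = D" and nonneg: "\<And>s t. D $ s $ t \<ge> 0" and q: "\<And>s. q $ s \<ge> 0"
    and u: "\<And>i j. u (i, j) = (if i < j then \<beta> / sqrt (real N) * sqrt (D $ sp i $ sp j) else 0)"
    and v: "\<And>i j. v (i, j) = (if i = j then \<beta> * sqrt (((D ** Lam N Sp) *v q) $ sp i) else 0)"
  shows "\<exists>r. \<forall>\<sigma>\<in>configs N. \<forall>\<tau>\<in>configs N.
    (\<Sum>k\<in>spin_couplings N. ((u k)\<^sup>2 - (v k)\<^sup>2) * (spin_monomial k \<sigma> * spin_monomial k \<tau>))
     = \<beta>\<^sup>2 / 2 * (real N * ((Lam N Sp *v (overlap Sp \<sigma> \<tau> - q)) \<bullet> (D *v (Lam N Sp *v (overlap Sp \<sigma> \<tau> - q))))) + r"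
proof (intro exI ballI)
  fix \<sigma> \<tau> assume C: "\<sigma> \<in> configs N" "\<tau> \<in> configs N"
  let ?J = "site_pairs N" and ?d = "(\<lambda>i. (i, i)) ` {1..N}"
  define a where "a = mean_sum q"
  define E where "E = spin_sum \<sigma> \<tau>"
  have w: "(D ** Lam N Sp) *v q = (1 / real N) *\<^sub>R (D *v a)"
    by (simp add: a_def Lam_mult_mean matrix_vector_mult_scaleR flip: matrix_vector_mul_assoc)
  have w0: "((D ** Lam N Sp) *v q) $ s \<ge> 0" for s
    unfolding w using nonneg q
    by (auto simp: matrix_vector_mult_def a_def mean_sum_def intro!: divide_nonneg_nonneg sum_nonneg)
  have e2: "(\<sigma> i * \<tau> i) * (\<sigma> i * \<tau> i) = 1" if "i \<in> {1..N}" for i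
    using configs_sq[OF C(1) that] configs_sq[OF C(2) that] by (simp add: mult_ac)
  have Dsym: "D $ s $ t = D $ t $ s" for s t
    using arg_cong[OF sym, of "\<lambda>X. X $ t $ s"] by (simp add: transpose_def)
  have K: "spin_couplings N = ?J \<union> ?d"
    by (auto simp: site_pairs_def spin_couplings_def image_iff)
  have split: "(\<Sum>k\<in>spin_couplings N. ((u k)\<^sup>2 - (v k)\<^sup>2) * (spin_monomial k \<sigma> * spin_monomial k \<tau>))
     = (\<Sum>k\<in>?J. ((u k)\<^sup>2 - (v k)\<^sup>2) * (spin_monomial k \<sigma> * spin_monomial k \<tau>))
     + (\<Sum>k\<in>?d. ((u k)\<^sup>2 - (v k)\<^sup>2) * (spin_monomial k \<sigma> * spin_monomial k \<tau>))"
    unfolding K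
    by (rule sum.union_disjoint[OF finite_site_pairs finite_imageI[OF finite_atLeastAtMost]])
      (auto simp: site_pairs_def)
  have J: "(\<Sum>k\<in>?J. ((u k)\<^sup>2 - (v k)\<^sup>2) * (spin_monomial k \<sigma> * spin_monomial k \<tau>))
     = \<beta>\<^sup>2 / real N * (\<Sum>(i, j)\<in>?J. D $ sp i $ sp j * (\<sigma> i * \<tau> i) * (\<sigma> j * \<tau> j))"
    unfolding sum_distrib_left
  proof (rule sum.cong[OF refl])
    fix k assume "k \<in> ?J"
    then obtain i j where k: "k = (i, j)" "i < j" by (auto simp: site_pairs_def)
    then have "(u k)\<^sup>2 = \<beta>\<^sup>2 / real N * D $ sp i $ sp j" "v k = 0"
      using nonneg by (simp_all add: u v power_mult_distrib power_divide)
    then show "((u k)\<^sup>2 - (v k)\<^sup>2) * (spin_monomial k \<sigma> * spin_monomial k \<tau>)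
      = \<beta>\<^sup>2 / real N * (case k of (i, j) \<Rightarrow> D $ sp i $ sp j * (\<sigma> i * \<tau> i) * (\<sigma> j * \<tau> j))"
      using k by (simp add: spin_monomial_def)
  qed
  have pairs: "(\<Sum>(i, j)\<in>?J. D $ sp i $ sp j * (\<sigma> i * \<tau> i) * (\<sigma> j * \<tau> j))
     = (E \<bullet> (D *v E) - (\<Sum>i=1..N. D $ sp i $ sp i)) / 2"
  proof -
    have "E \<bullet> (D *v E) = 2 * (\<Sum>(i, j)\<in>?J. D $ sp i $ sp j * (\<sigma> i * \<tau> i) * (\<sigma> j * \<tau> j))
       + (\<Sum>i=1..N. D $ sp i $ sp i * (\<sigma> i * \<tau> i) * (\<sigma> i * \<tau> i))"
      unfolding E_def pair_sum_eq[symmetric]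
      by (rule sum_symmetric_pairs) (simp add: mult_ac Dsym)
    also have "(\<Sum>i=1..N. D $ sp i $ sp i * (\<sigma> i * \<tau> i) * (\<sigma> i * \<tau> i)) = (\<Sum>i=1..N. D $ sp i $ sp i)"
      using e2 by (intro sum.cong refl) (simp only: mult.assoc mult_1_right)
    finally show ?thesis by simp
  qed
  have diagonal: "(\<Sum>k\<in>?d. ((u k)\<^sup>2 - (v k)\<^sup>2) * (spin_monomial k \<sigma> * spin_monomial k \<tau>))
     = - (\<beta>\<^sup>2 / real N * ((D *v a) \<bullet> E))"
  proof -
    have "(\<Sum>k\<in>?d. ((u k)\<^sup>2 - (v k)\<^sup>2) * (spin_monomial k \<sigma> * spin_monomial k \<tau>))
      = (\<Sum>i=1..N. - (\<beta>\<^sup>2 * ((D ** Lam N Sp) *v q) $ sp i) * (\<sigma> i * \<tau> i))"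
      by (subst sum.reindex) (auto simp: inj_on_def u v spin_monomial_def power_mult_distrib w0)
    also have "\<dots> = (\<Sum>s\<in>UNIV. - (\<beta>\<^sup>2 * ((D ** Lam N Sp) *v q) $ s) * E $ s)"
      by (subst sum_species[of "\<lambda>s i. - (\<beta>\<^sup>2 * ((D ** Lam N Sp) *v q) $ s) * (\<sigma> i * \<tau> i)"])
        (simp only: E_def spin_sum_def vec_lambda_beta sum_distrib_left)
    also have "\<dots> = - (\<beta>\<^sup>2 / real N * ((D *v a) \<bullet> E))"
      by (simp add: w inner_vec_def sum_distrib_left sum_negf mult_ac)
    finally show ?thesis .
  qed
  have square: "\<beta>\<^sup>2 / real N * ((E \<bullet> (D *v E) - (\<Sum>i=1..N. D $ sp i $ sp i)) / 2) + - (\<beta>\<^sup>2 / real N * ((D *v a) \<bullet> E))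
     = \<beta>\<^sup>2 / 2 * (1 / real N * ((E - a) \<bullet> (D *v (E - a))))
       + - (\<beta>\<^sup>2 / (2 * real N) * ((\<Sum>i=1..N. D $ sp i $ sp i) + a \<bullet> (D *v a)))"
  proof -
    have "(E - a) \<bullet> (D *v (E - a)) = E \<bullet> (D *v E) - 2 * ((D *v a) \<bullet> E) + a \<bullet> (D *v a)"
      using inner_symmetric_mult[OF sym, of a E] inner_commute[of E "D *v a"]
      by (simp add: matrix_vector_mult_diff_distrib inner_diff_left inner_diff_right)
    moreover have "b / n * ((e - x) / 2) + - (b / n * c) = b / 2 * (1 / n * (e - 2 * c + d)) + - (b / (2 * n) * (x + d))"
      if "n \<noteq> 0" for b n e x c d :: real
      using that by (simp add: field_simps)
    ultimately show ?thesis using N_pos by simp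
  qed
  have overlap: "1 / real N * ((E - a) \<bullet> (D *v (E - a)))
     = real N * ((Lam N Sp *v (overlap Sp \<sigma> \<tau> - q)) \<bullet> (D *v (Lam N Sp *v (overlap Sp \<sigma> \<tau> - q))))"
    using N_pos by (simp add: Lam_mult_overlap E_def a_def matrix_vector_mult_scaleR)
  show "(\<Sum>k\<in>spin_couplings N. ((u k)\<^sup>2 - (v k)\<^sup>2) * (spin_monomial k \<sigma> * spin_monomial k \<tau>))
     = \<beta>\<^sup>2 / 2 * (real N * ((Lam N Sp *v (overlap Sp \<sigma> \<tau> - q)) \<bullet> (D *v (Lam N Sp *v (overlap Sp \<sigma> \<tau> - q)))))
      + - (\<beta>\<^sup>2 / (2 * real N) * ((\<Sum>i=1..N. D $ sp i $ sp i) + mean_sum q \<bullet> (D *v mean_sum q)))"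
    unfolding split J pairs diagonal square overlap by (simp only: a_def)
qed

text \<open>
  The entry of a species is the centered sum of the products of the spins over its sites, divided by the
  square root of their number, the scale of the central limit theorem.
\<close>
definition fluctuation :: "real ^ 'm \<Rightarrow> (nat \<Rightarrow> real) \<times> (nat \<Rightarrow> real) \<Rightarrow> real ^ 'm" where
  "fluctuation q a = sqrt (real N) *\<^sub>R (sqrt_Lam N Sp *v (overlap Sp (fst a) (snd a) - q))"

lemma inner_fluctuation:
  "w \<bullet> fluctuation q (\<sigma>, \<tau>)
    = (\<Sum>i=1..N. w $ sp i / sqrt (real (card (Sp (sp i)))) * (\<sigma> i * \<tau> i - q $ sp i))"
proof -
  have "(\<Sum>i=1..N. w $ sp i / sqrt (real (card (Sp (sp i)))) * (\<sigma> i * \<tau> i - q $ sp i))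
    = (\<Sum>s\<in>UNIV. w $ s / sqrt (real (card (Sp s))) * ((\<Sum>i\<in>Sp s. \<sigma> i * \<tau> i) - real (card (Sp s)) * q $ s))"
    by (subst sum_species[of "\<lambda>s i. w $ s / sqrt (real (card (Sp s))) * (\<sigma> i * \<tau> i - q $ s)"])
      (simp only: sum_distrib_left[symmetric] sum_subtractf sum_constant)
  also have "\<dots> = w \<bullet> fluctuation q (\<sigma>, \<tau>)"
    unfolding inner_vec_def
  proof (rule sum.cong[OF refl])
    fix s
    define n where "n = real (card (Sp s))"
    have n: "n > 0" using card_Sp_pos by (simp add: n_def)
    have "fluctuation q (\<sigma>, \<tau>) $ s = sqrt n * ((\<Sum>i\<in>Sp s. \<sigma> i * \<tau> i) / n - q $ s)"
      using N_pos by (simp add: fluctuation_def sqrt_Lam_def diag_mult_vec species_ratio_def overlap_def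
          real_sqrt_divide n_def)
    also have "\<dots> = ((\<Sum>i\<in>Sp s. \<sigma> i * \<tau> i) - n * q $ s) / sqrt n"
    proof -
      have "r * (e / (r * r) - x) = (e - r * r * x) / r" if "r > 0" for r e x :: real
        using that by (simp add: field_simps)
      from this[of "sqrt n"] show ?thesis using n by simp
    qed
    finally show "w $ s / sqrt (real (card (Sp s))) * ((\<Sum>i\<in>Sp s. \<sigma> i * \<tau> i) - real (card (Sp s)) * q $ s)
      = w $ s \<bullet> fluctuation q (\<sigma>, \<tau>) $ s"
      by (simp add: n_def)
  qed
  finally show ?thesis by simp
qed

lemma sum_sq_coefficients:
  "(\<Sum>i=1..N. (w $ sp i / sqrt (real (card (Sp (sp i)))))\<^sup>2) = w \<bullet> w"
proof -
  have "(\<Sum>i=1..N. (w $ sp i / sqrt (real (card (Sp (sp i)))))\<^sup>2)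
    = (\<Sum>s\<in>UNIV. \<Sum>i\<in>Sp s. (w $ s / sqrt (real (card (Sp s))))\<^sup>2)"
    by (rule sum_species[of "\<lambda>s i. (w $ s / sqrt (real (card (Sp s))))\<^sup>2"])
  also have "\<dots> = w \<bullet> w"
    unfolding inner_vec_def
    by (rule sum.cong) (use card_Sp_pos in \<open>auto simp: power_divide power2_eq_square\<close>)
  finally show ?thesis .
qed

end

section \<open>The exponential moment of the overlap\<close>

theorem theorem1p7:
  fixes M :: "'a measure"
    and N :: nat
    and Sp :: "'m::finite \<Rightarrow> nat set"
    and D :: "real ^ 'm ^ 'm"
    and g :: "nat \<Rightarrow> nat \<Rightarrow> 'a \<Rightarrow> real"
    and \<beta> h \<eta> :: real
    and q :: "real ^ 'm"
  assumes "CARD('m) \<ge> 2"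
    and "transpose D = D"
    and "invertible D"
    and "D \<noteq> 0"
    and "\<And>s t. D $ s $ t \<ge> 0"
    and "species_partition N Sp"
    and "gaussian_disorder M N Sp D g"
    and "h \<ge> 0"
    and "0 < \<beta>"
    and "\<beta> < beta_0 N Sp D"
    and "is_rs_overlap N Sp D \<beta> h q"
    and "\<eta> > 0"
    and "2 * \<eta> < (beta_c N Sp D)\<^sup>2 - 4 * alpha D * \<beta>\<^sup>2"
  shows "nu M N \<beta> h g (\<lambda>\<sigma>1 \<sigma>2. exp (\<eta> * real N * Pform N Sp D (overlap Sp \<sigma>1 \<sigma>2 - q)))
           \<le> det (mat 1 - (2 * \<eta> + 4 * alpha D * \<beta>\<^sup>2) *\<^sub>R Vmat N Sp D) powr (-1/2)"
proof -
  note sym = assms(2) and nonneg = assms(5) and part = assms(6)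
  define sp where "sp i = (THE s. i \<in> Sp s)" for i
  have sp: "sp i = s" if "i \<in> Sp s" for i s
    unfolding sp_def using that part
    by (intro the_equality) (auto simp: species_partition_def disjoint_family_on_def)
  have species: "species N Sp sp"
    by unfold_locales (use part sp in auto)
  let ?fluctuation = "species.fluctuation N Sp q"
  let ?A = "sqrt_Lam N Sp ** D ** sqrt_Lam N Sp"
  let ?P = "gaussian_family (spin_couplings N)"
  \<comment> \<open>Two species need two sites, so there is at least one Gaussian coupling.\<close>
  have ne: "site_pairs N \<noteq> {}"
  proof -
    obtain s t :: 'm where st: "s \<noteq> t"
      using assms(1) card_le_Suc0_iff_eq[of "UNIV :: 'm set"] by auto
    have "Sp s \<noteq> {}" "Sp t \<noteq> {}" using part by (auto simp: species_partition_def)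
    then obtain i j where ij: "i \<in> Sp s" "j \<in> Sp t" by blast
    then have "i \<noteq> j" using sp st by auto
    moreover have "i \<in> {1..N}" "j \<in> {1..N}" using ij species.Sp_subset[OF species] by blast+
    ultimately have "(i, j) \<in> site_pairs N \<or> (j, i) \<in> site_pairs N" by (auto simp: site_pairs_def)
    then show ?thesis by blast
  qed
  define l :: "real ^ 'm" where "l = (\<chi> s. sqrt (species_ratio N Sp $ s))"
  have l: "l $ s > 0" for s using species.ratio_pos[OF species] by (simp add: l_def)
  have sqrt_Lam: "sqrt_Lam N Sp = diag l" by (simp add: sqrt_Lam_def l_def)
  have Lam: "Lam N Sp = diag l ** diag l"
    using species.ratio_pos[OF species] by (auto simp: vec_eq_iff matrix_mult_diag_left Lam_def l_def)
      (auto simp: diag_def less_imp_le)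
  have "transpose ?A = ?A"
    by (simp add: sqrt_Lam matrix_transpose_mul transpose_diag sym matrix_mul_assoc)
  then obtain U d where U: "orthogonal_matrix U" and dec: "?A = U ** diag d ** transpose U"
    by (rule spectral_decomposition)
  define e where "e = (\<chi> i. \<bar>d $ i\<bar>)"
  have V: "Vmat N Sp D = U ** diag e ** transpose U"
    unfolding Vmat_def e_def by (rule matrix_abs_eq[OF U dec])
  \<comment> \<open>The exponent at the end of the interpolation path where the spins are independent.\<close>
  define c where "c = \<eta> + 2 * alpha D * \<beta>\<^sup>2"
  have \<alpha>: "alpha D \<ge> 1" by (simp add: alpha_def)
  have c: "c \<ge> 0" using assms(12) \<alpha> by (simp add: c_def)
  \<comment> \<open>The condition on \<open>\<eta>\<close> says that \<open>2 c\<close> is below the inverse of the spectral radius.\<close>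
  have gap: "2 * c * e $ i < 1" for i
  proof -
    define \<rho> where "\<rho> = spectral_rad (D ** Lam N Sp)"
    have \<rho>: "\<rho> = Max (range (\<lambda>i. \<bar>d $ i\<bar>))"
      unfolding \<rho>_def Lam by (rule spectral_rad_eq_Max[OF l U]) (use dec in \<open>simp add: sqrt_Lam\<close>)
    have e\<rho>: "e $ i \<le> \<rho>" unfolding \<rho> e_def by (simp add: Max_ge)
    then have "\<rho> \<ge> 0" by (simp add: e_def) 
    have bc: "2 * c < (beta_c N Sp D)\<^sup>2"
      using assms(13) by (simp add: c_def)
    then have "(beta_c N Sp D)\<^sup>2 \<noteq> 0" using c by linarith
    then have "\<rho> \<noteq> 0" by (auto simp: beta_c_def \<rho>_def)
    then have "\<rho> > 0" using \<open>\<rho> \<ge> 0\<close> by simp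
    then have "(beta_c N Sp D)\<^sup>2 = 1 / \<rho>"
      by (simp add: beta_c_def \<rho>_def[symmetric] power2_eq_square powr_minus_divide flip: powr_add)
    then have "2 * c * \<rho> < 1" using mult_strict_right_mono[OF bc \<open>\<rho> > 0\<close>] \<open>\<rho> > 0\<close> by simp
    moreover have "2 * c * e $ i \<le> 2 * c * \<rho>" using e\<rho> c by (intro mult_left_mono) auto
    ultimately show ?thesis by linarith
  qed
  define y where "y x = sqrt_Lam N Sp *v x" for x :: "real ^ 'm"
  define Q where "Q x = (Lam N Sp *v x) \<bullet> (D *v (Lam N Sp *v x))" for x
  have P: "Pform N Sp D x = (\<Sum>i\<in>UNIV. e $ i * ((transpose U *v y x) $ i)\<^sup>2)" for x
    unfolding quadratic_form_diagonalized[symmetric] V[symmetric] Pform_def y_def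
    by (simp add: sqrt_Lam inner_diag_mult flip: matrix_vector_mul_assoc)
  have Q: "Q x = (\<Sum>i\<in>UNIV. d $ i * ((transpose U *v y x) $ i)\<^sup>2)" for x
    unfolding quadratic_form_diagonalized[symmetric] dec[symmetric] Q_def y_def Lam sqrt_Lam
    by (simp add: inner_diag_mult flip: matrix_vector_mul_assoc)
  have QP: "Q x \<le> Pform N Sp D x" for x
    unfolding P Q by (intro sum_mono mult_right_mono) (auto simp: e_def)
  \<comment> \<open>This is where \<open>\<alpha>\<close> distinguishes the cases: \<open>Q\<close> is nonnegative unless \<open>D\<close> is indefinite.\<close>
  have PQ: "- Q x \<le> (alpha D - 1) * Pform N Sp D x" for x
  proof (cases "indefinite D")
    case True
    have "- Q x \<le> Pform N Sp D x"
      unfolding P Q sum_negf[symmetric] mult_minus_left[symmetric]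
      by (intro sum_mono mult_right_mono) (auto simp: e_def)
    then show ?thesis using True by (simp add: alpha_def)
  next
    case False
    then have "Q x \<ge> 0" unfolding Q_def using nonneg assms(4) by (intro not_indefinite_imp_psd)
    then show ?thesis using False by (simp add: alpha_def)
  qed
  define W where "W \<sigma> \<tau> = real N * Pform N Sp D (overlap Sp \<sigma> \<tau> - q)" for \<sigma> \<tau>
  define u where "u k = (case k of (i, j) \<Rightarrow>
    if i < j then \<beta> / sqrt (real N) * sqrt (D $ sp i $ sp j) else 0)" for k
  define r where "r i = \<beta> * sqrt (((D ** Lam N Sp) *v q) $ sp i)" for i
  define v where "v k = (case k of (i, j) \<Rightarrow> if i = j then r i else 0)" for k
  have q: "0 \<le> q $ s" "q $ s \<le> 1" for s
    using assms(11) unfolding is_rs_overlap_def atLeastAtMost_iff by blast+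
  have "\<exists>r. \<forall>\<sigma>\<in>configs N. \<forall>\<tau>\<in>configs N.
     (\<Sum>k\<in>spin_couplings N. ((u k)\<^sup>2 - (v k)\<^sup>2) * (spin_monomial k \<sigma> * spin_monomial k \<tau>))
       = \<beta>\<^sup>2 / 2 * (real N * Q (overlap Sp \<sigma> \<tau> - q)) + r"
    unfolding Q_def
    by (rule species.covariance_difference[OF species sym nonneg q(1)]) (auto simp: u_def v_def r_def)
  then obtain r0 where \<kappa>: "\<And>\<sigma> \<tau>. \<sigma> \<in> configs N \<Longrightarrow> \<tau> \<in> configs N \<Longrightarrow>
     (\<Sum>k\<in>spin_couplings N. ((u k)\<^sup>2 - (v k)\<^sup>2) * (spin_monomial k \<sigma> * spin_monomial k \<tau>))
       = \<beta>\<^sup>2 / 2 * (real N * Q (overlap Sp \<sigma> \<tau> - q)) + r0"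
    by blast
  have "nu M N \<beta> h g (\<lambda>\<sigma>1 \<sigma>2. exp (\<eta> * real N * Pform N Sp D (overlap Sp \<sigma>1 \<sigma>2 - q)))
     = (\<integral>\<xi>. spin_avg2 N h (\<lambda>k. u k * \<xi> k) (\<lambda>\<sigma> \<tau>. exp (\<eta> * W \<sigma> \<tau>)) \<partial>?P)"
    unfolding W_def mult.assoc[symmetric]
    by (rule nu_eq_gaussian_integral[OF assms(7) ne species.sp_mem[OF species]]) (auto simp: u_def)
  also have "\<dots> \<le> (\<integral>\<xi>. spin_avg2 N h (\<lambda>k. v k * \<xi> k)
      (\<lambda>\<sigma> \<tau>. exp ((\<eta> + 4 * alpha D * (\<beta>\<^sup>2 / 2)) * W \<sigma> \<tau>)) \<partial>?P)"
  proof (rule finite_gibbs.gaussian_comparison[OF finite_gibbs_spin _ _ \<alpha> _ \<kappa>])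
    show "W \<sigma> \<tau> = W \<tau> \<sigma>" for \<sigma> \<tau> by (simp add: W_def overlap_def mult.commute)
    show "real N * Q (overlap Sp \<sigma> \<tau> - q) \<le> W \<sigma> \<tau>" for \<sigma> \<tau>
      unfolding W_def by (intro mult_left_mono QP) simp
    show "- (real N * Q (overlap Sp \<sigma> \<tau> - q)) \<le> (alpha D - 1) * W \<sigma> \<tau>" for \<sigma> \<tau>
      using mult_left_mono[OF PQ, of "real N"] by (simp add: W_def mult_ac)
    show "u k * v k = 0" for k by (cases k) (simp add: u_def v_def)
  qed (use assms(12) in auto)
  also have "\<eta> + 4 * alpha D * (\<beta>\<^sup>2 / 2) = c" by (simp add: c_def)
  also have "(\<integral>\<xi>. spin_avg2 N h (\<lambda>k. v k * \<xi> k) (\<lambda>\<sigma> \<tau>. exp (c * W \<sigma> \<tau>)) \<partial>?P)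
     \<le> (\<Prod>i\<in>UNIV. (1 - 2 * c * e $ i) powr (-1/2))"
  proof -
    define w where "w a = (\<integral>\<xi>. spin_weight N h (\<lambda>k. v k * \<xi> k) (fst a) / spin_Z N h (\<lambda>k. v k * \<xi> k)
        * (spin_weight N h (\<lambda>k. v k * \<xi> k) (snd a) / spin_Z N h (\<lambda>k. v k * \<xi> k)) \<partial>?P)" for a
    have as_sum: "(\<integral>\<xi>. spin_avg2 N h (\<lambda>k. v k * \<xi> k) F \<partial>?P)
        = (\<Sum>a\<in>configs N \<times> configs N. w a * F (fst a) (snd a))" for F
      unfolding w_def
      by (rule finite_gibbs.integral_avg2_eq_sum[OF finite_gibbs_spin prob_space_gaussian_family])
        (use borel_measurable_gaussian_component in \<open>auto intro!: borel_measurable_times\<close>)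
    have W_eq: "W (fst a) (snd a) = (\<Sum>i\<in>UNIV. e $ i * ((transpose U *v ?fluctuation a) $ i)\<^sup>2)" for a
      by (simp add: W_def P species.fluctuation_def[OF species] y_def matrix_vector_mult_scaleR power_mult_distrib
          sum_distrib_left mult_ac)
    have "(\<Sum>a\<in>configs N \<times> configs N. w a * exp (z \<bullet> ?fluctuation a)) \<le> exp (z \<bullet> z / 2)" for z
    proof -
      define b where "b i = z $ sp i / sqrt (real (card (Sp (sp i))))" for i
      have "(\<Sum>a\<in>configs N \<times> configs N. w a * exp (z \<bullet> ?fluctuation a))
        = (\<integral>\<xi>. spin_avg2 N h (\<lambda>k. v k * \<xi> k) (\<lambda>\<sigma> \<tau>. exp (\<Sum>i=1..N. b i * (\<sigma> i * \<tau> i - q $ sp i))) \<partial>?P)"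
        unfolding as_sum b_def species.inner_fluctuation[OF species, symmetric] by simp
      also have "\<dots> \<le> exp ((\<Sum>i=1..N. (b i)\<^sup>2) / 2)"
      proof (rule external_field_subgaussian)
        show "\<bar>q $ sp i\<bar> \<le> 1" for i using q[of "sp i"] by simp
        show "q $ sp i = (\<integral>x. (tanh (r i * x + h))\<^sup>2 \<partial>gaussian)" for i
          using assms(11) unfolding is_rs_overlap_def r_def by (simp add: mult_ac)
        show "v (i, j) = (if i = j then r i else 0)" for i j by (simp add: v_def)
      qed
      finally show ?thesis unfolding b_def species.sum_sq_coefficients[OF species] .
    qed
    then have "(\<Sum>a\<in>configs N \<times> configs N.
          w a * exp (c * (\<Sum>i\<in>UNIV. e $ i * ((transpose U *v ?fluctuation a) $ i)\<^sup>2)))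
        \<le> (\<Prod>i\<in>UNIV. (1 - 2 * c * e $ i) powr (-1/2))"
      by (rule gaussian_linearization[OF finite_cartesian_product[OF finite_configs finite_configs] _ U _ c gap])
        (simp add: e_def)
    then show ?thesis unfolding as_sum W_eq .
  qed
  also have "\<dots> = (\<Prod>i\<in>UNIV. 1 - 2 * c * e $ i) powr (-1/2)"
    by (rule prod_powr_distrib[symmetric])
  also have "(\<Prod>i\<in>UNIV. 1 - 2 * c * e $ i) = det (mat 1 - (2 * \<eta> + 4 * alpha D * \<beta>\<^sup>2) *\<^sub>R Vmat N Sp D)"
    unfolding V det_one_minus_diagonalized[OF U] by (simp add: c_def mult.assoc)
  finally show ?thesis .
qed

end
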